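(* Let $(M,\alpha_1,\alpha_2,\phi,g)$ be a metric contact pair manifold with decomposable $\phi$ and Reeb vector fields $Z_1$ and $Z_2$. Suppose that the almost complex structure $J=\phi-\alpha_2\otimes Z_1+\alpha_1\otimes Z_2$ is integrable. Then a $J$-invariant submanifold $N$ of $M$ is minimal if and only if it is tangent to the Reeb distribution (that is, $(Z_1)_p,(Z_2)_p\in T_pN$ for all $p\in N$).
   Context: All objects are smooth. Convention: $d\alpha(X,Y)=\frac12[X\alpha(Y)-Y\alpha(X)-\alpha([X,Y])]$. Contact pair: a contact pair of type $(h,k)$ ($h,k\ge 0$ integers) on a manifold $M$ is a pair $(\alpha_1,\alpha_2)$ of 1-forms such that $\alpha_1\wedge(d\alpha_1)^h\wedge\alpha_2\wedge(d\alpha_2)^k$ is a volume form, $(d\alpha_1)^{h+1}=0$ and $(d\alpha_2)^{k+1}=0$ (so $\dim M=2h+2k+2$). Its Reeb vector fields $Z_1,Z_2$ are the unique vector fields with $\alpha_i(Z_j)=\delta_{ij}$ and $i_{Z_i}d\alpha_j=0$ for $i,j=1,2$; the Reeb distribution is the distribution spanned by $Z_1,Z_2$. The distribution $\ker\alpha_i\cap\ker d\alpha_i$ is integrable and defines the characteristic foliation $\mathcal{F}_i$ of $\alpha_i$, and $TM=T\mathcal{F}_1\oplus T\mathcal{F}_2$. Metric contact pair (MCP): a 4-tuple $(\alpha_1,\alpha_2,\phi,g)$ where $(\alpha_1,\alpha_2)$ is a contact pair on $M$ with Reeb vector fields $Z_1,Z_2$, $\phi$ is an endomorphism field of $TM$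 with $\phi^2=-\mathrm{Id}+\alpha_1\otimes Z_1+\alpha_2\otimes Z_2$ and $\phi Z_1=\phi Z_2=0$, and $g$ is a Riemannian metric with $g(X,\phi Y)=(d\alpha_1+d\alpha_2)(X,Y)$ and $g(X,Z_i)=\alpha_i(X)$, $i=1,2$. $\phi$ is decomposable if $\phi(T\mathcal{F}_i)\subset T\mathcal{F}_i$ for $i=1,2$. A submanifold $N$ of $M$ is $J$-invariant if $J_p(T_pN)\subset T_pN$ for all $p\in N$. $N$ is minimal if the trace of its second fundamental form (with respect to $g$) vanishes identically.
   Formalization: The submanifold N is taken to have dimension at least 1; for a single point the claim fails, since a point is trivially J-invariant and minimal but its zero tangent space does not contain the Reeb vectors. *)

theory Defs
  imports "HOL-Analysis.Analysis"
begin

section \<open>Calculus on open subsets of Euclidean spaces\<close>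

abbreviation ddir :: "('a::real_normed_vector \<Rightarrow> 'b::real_normed_vector) \<Rightarrow> 'a \<Rightarrow> 'a \<Rightarrow> 'b"
  where "ddir f x v \<equiv> frechet_derivative f (at x) v"

primrec ck_on :: "nat \<Rightarrow> 'a::euclidean_space set \<Rightarrow> ('a \<Rightarrow> 'b::real_normed_vector) \<Rightarrow> bool" where
  "ck_on 0 S f \<longleftrightarrow> continuous_on S f"
| "ck_on (Suc n) S f \<longleftrightarrow>
     (\<forall>x\<in>S. f differentiable (at x)) \<and> (\<forall>v. ck_on n S (\<lambda>x. ddir f x v))"

text \<open>Only used for open \<open>S\<close>.\<close>

definition smooth_on :: "'a::euclidean_space set \<Rightarrow> ('a \<Rightarrow> 'b::real_normed_vector) \<Rightarrow> bool"
  where "smooth_on S f \<longleftrightarrow> (\<forall>n. ck_on n S f)"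

definition lie_bracket ::
    "('e::euclidean_space \<Rightarrow> 'e) \<Rightarrow> ('e \<Rightarrow> 'e) \<Rightarrow> 'e \<Rightarrow> 'e"
  where "lie_bracket X Y x = ddir Y x (X x) - ddir X x (Y x)"

definition ext_deriv_fields ::
    "('e::euclidean_space \<Rightarrow> 'e \<Rightarrow> real) \<Rightarrow> ('e \<Rightarrow> 'e) \<Rightarrow> ('e \<Rightarrow> 'e) \<Rightarrow> 'e \<Rightarrow> real"
  where "ext_deriv_fields a X Y x =
    1/2 * (ddir (\<lambda>z. a z (Y z)) x (X x) - ddir (\<lambda>z. a z (X z)) x (Y x) - a x (lie_bracket X Y x))"

text \<open>The right-hand side above is tensorial in \<open>X\<close>, \<open>Y\<close>, so the 2-form at \<open>x\<close> is obtained by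
  extending \<open>u\<close> and \<open>v\<close> to constant fields; see \<open>ext_deriv_eq_fields\<close> below.\<close>

definition ext_deriv ::
    "('e::euclidean_space \<Rightarrow> 'e \<Rightarrow> real) \<Rightarrow> 'e \<Rightarrow> 'e \<Rightarrow> 'e \<Rightarrow> real"
  where "ext_deriv a x u v = ext_deriv_fields a (\<lambda>_. u) (\<lambda>_. v) x"

definition nijenhuis ::
    "('e::euclidean_space \<Rightarrow> 'e \<Rightarrow> 'e) \<Rightarrow> ('e \<Rightarrow> 'e) \<Rightarrow> ('e \<Rightarrow> 'e) \<Rightarrow> 'e \<Rightarrow> 'e"
  where "nijenhuis J X Y x =
    lie_bracket (\<lambda>z. J z (X z)) (\<lambda>z. J z (Y z)) x
    - J x (lie_bracket (\<lambda>z. J z (X z)) Y x)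
    - J x (lie_bracket X (\<lambda>z. J z (Y z)) x)
    + J x (J x (lie_bracket X Y x))"

text \<open>The Levi-Civita connection is \<open>(\<nabla>\<^sub>X Y)(x) = DY(x)(X x) + \<Gamma>\<^sub>x(X x, Y x)\<close>, where
  \<open>\<Gamma>\<^sub>x(u, v)\<close> is the vector below (Koszul formula for constant fields).\<close>

definition christoffel ::
    "('e::euclidean_space \<Rightarrow> 'e \<Rightarrow> 'e \<Rightarrow> real) \<Rightarrow> 'e \<Rightarrow> 'e \<Rightarrow> 'e \<Rightarrow> 'e"
  where "christoffel g x u v = (THE w. \<forall>z. g x w z =
    1/2 * (ddir (\<lambda>y. g y v z) x u + ddir (\<lambda>y. g y u z) x v - ddir (\<lambda>y. g y u v) x z))"

text \<open>Covariant derivative, in the direction \<open>u\<close>, of a vector field \<open>V\<close> along the map \<open>f\<close>.\<close>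

definition cov_deriv_along ::
    "('e::euclidean_space \<Rightarrow> 'e \<Rightarrow> 'e \<Rightarrow> real) \<Rightarrow> ('f::euclidean_space \<Rightarrow> 'e) \<Rightarrow> ('f \<Rightarrow> 'e)
      \<Rightarrow> 'f \<Rightarrow> 'f \<Rightarrow> 'e"
  where "cov_deriv_along g f V y u = ddir V y u + christoffel g (f y) (ddir f y u) (V y)"

definition normal_part ::
    "('e::euclidean_space \<Rightarrow> 'e \<Rightarrow> real) \<Rightarrow> 'e set \<Rightarrow> 'e \<Rightarrow> 'e"
  where "normal_part h W v = (THE n. v - n \<in> W \<and> (\<forall>w\<in>W. h n w = 0))"

text \<open>Second fundamental form \<open>(\<nabla>\<^sub>X Y)\<^sup>\<bottom>\<close> of the immersion \<open>f\<close> for the (coordinate) fields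
  \<open>X = Df u\<close>, \<open>Y = Df w\<close>.\<close>

definition second_fundamental_form ::
    "('e::euclidean_space \<Rightarrow> 'e \<Rightarrow> 'e \<Rightarrow> real) \<Rightarrow> ('f::euclidean_space \<Rightarrow> 'e)
      \<Rightarrow> 'f \<Rightarrow> 'f \<Rightarrow> 'f \<Rightarrow> 'e"
  where "second_fundamental_form g f y u w =
    normal_part (g (f y)) (range (ddir f y)) (cov_deriv_along g f (\<lambda>z. ddir f z w) y u)"

definition orthonormal_basis :: "('f::euclidean_space \<Rightarrow> 'f \<Rightarrow> real) \<Rightarrow> 'f set \<Rightarrow> bool"
  where "orthonormal_basis h E \<longleftrightarrow> finite E \<and> span E = UNIV \<and>
    (\<forall>e\<in>E. \<forall>e'\<in>E. h e e' = (if e = e' then 1 else 0))"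


section \<open>Exterior algebra at a point\<close>

text \<open>A \<open>p\<close>-form is a function of a sequence of vectors that depends on its first \<open>p\<close> entries only.
  The normalisation \<open>1 / (p+q)!\<close> is the one matching the factor \<open>1/2\<close> in \<^const>\<open>ext_deriv_fields\<close>.\<close>

type_synonym 'e form = "(nat \<Rightarrow> 'e) \<Rightarrow> real"

definition wedge :: "nat \<Rightarrow> nat \<Rightarrow> 'e form \<Rightarrow> 'e form \<Rightarrow> 'e form"
  where "wedge p q \<omega> \<eta> v =
    (\<Sum>\<sigma> | \<sigma> permutes {..<p + q}.
       of_int (sign \<sigma>) * \<omega> (\<lambda>i. v (\<sigma> i)) * \<eta> (\<lambda>i. v (\<sigma> (p + i)))) / fact (p + q)"

primrec wedge_power :: "nat \<Rightarrow> 'e form \<Rightarrow> nat \<Rightarrow> 'e form" where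
  "wedge_power p \<omega> 0 = (\<lambda>v. 1)"
| "wedge_power p \<omega> (Suc n) = wedge p (n * p) \<omega> (wedge_power p \<omega> n)"

definition form1 :: "('e \<Rightarrow> real) \<Rightarrow> 'e form"
  where "form1 a v = a (v 0)"

definition form2 :: "('e \<Rightarrow> 'e \<Rightarrow> real) \<Rightarrow> 'e form"
  where "form2 b v = b (v 0) (v 1)"


section \<open>Smooth manifolds and tensor fields\<close>

text \<open>A chart is a domain together with a coordinate map (arbitrary outside the domain).  Manifolds
  are modelled on a type of class \<^class>\<open>euclidean_space\<close>, hence have constant dimension
  \<open>\<ge> 1\<close>.\<close>

type_synonym ('p, 'e) chart = "'p set \<times> ('p \<Rightarrow> 'e)"

definition chart_image :: "('p, 'e) chart \<Rightarrow> 'e set"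
  where "chart_image c = snd c ` fst c"

definition chart_overlap :: "('p, 'e) chart \<Rightarrow> ('p, 'f) chart \<Rightarrow> 'e set"
  where "chart_overlap c d = snd c ` (fst c \<inter> fst d)"

definition chart_trans :: "('p, 'e) chart \<Rightarrow> ('p, 'f) chart \<Rightarrow> 'e \<Rightarrow> 'f"
  where "chart_trans c d = snd d \<circ> inv_into (fst c) (snd c)"

definition smooth_manifold :: "'p topology \<Rightarrow> ('p, 'e::euclidean_space) chart set \<Rightarrow> bool"
  where "smooth_manifold T A \<longleftrightarrow>
    Hausdorff_space T \<and>
    (\<exists>\<B>. countable \<B> \<and> openin T = arbitrary union_of (\<lambda>U. U \<in> \<B>)) \<and>
    topspace T = (\<Union>c\<in>A. fst c) \<and>
    (\<forall>c\<in>A. openin T (fst c) \<and> open (chart_image c) \<and>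
       homeomorphic_map (subtopology T (fst c)) (top_of_set (chart_image c)) (snd c)) \<and>
    (\<forall>c\<in>A. \<forall>d\<in>A. smooth_on (chart_overlap c d) (chart_trans c d))"

text \<open>Tensor fields are given by their components in the charts: the first argument is the chart,
  the second the coordinates of the point, and components in different charts are related by the
  derivative of the change of coordinates.\<close>

definition vector_field ::
    "('p, 'e::euclidean_space) chart set \<Rightarrow> (('p, 'e) chart \<Rightarrow> 'e \<Rightarrow> 'e) \<Rightarrow> bool"
  where "vector_field A X \<longleftrightarrow>
    (\<forall>c\<in>A. smooth_on (chart_image c) (X c)) \<and>
    (\<forall>c\<in>A. \<forall>d\<in>A. \<forall>x\<in>chart_overlap c d.
       X d (chart_trans c d x) = ddir (chart_trans c d) x (X c x))"

definition one_form ::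
    "('p, 'e::euclidean_space) chart set \<Rightarrow> (('p, 'e) chart \<Rightarrow> 'e \<Rightarrow> 'e \<Rightarrow> real) \<Rightarrow> bool"
  where "one_form A \<alpha> \<longleftrightarrow>
    (\<forall>c\<in>A. (\<forall>v. smooth_on (chart_image c) (\<lambda>x. \<alpha> c x v)) \<and>
       (\<forall>x\<in>chart_image c. linear (\<alpha> c x))) \<and>
    (\<forall>c\<in>A. \<forall>d\<in>A. \<forall>x\<in>chart_overlap c d. \<forall>v.
       \<alpha> d (chart_trans c d x) (ddir (chart_trans c d) x v) = \<alpha> c x v)"

definition endomorphism_field ::
    "('p, 'e::euclidean_space) chart set \<Rightarrow> (('p, 'e) chart \<Rightarrow> 'e \<Rightarrow> 'e \<Rightarrow> 'e) \<Rightarrow> bool"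
  where "endomorphism_field A \<phi> \<longleftrightarrow>
    (\<forall>c\<in>A. (\<forall>v. smooth_on (chart_image c) (\<lambda>x. \<phi> c x v)) \<and>
       (\<forall>x\<in>chart_image c. linear (\<phi> c x))) \<and>
    (\<forall>c\<in>A. \<forall>d\<in>A. \<forall>x\<in>chart_overlap c d. \<forall>v.
       \<phi> d (chart_trans c d x) (ddir (chart_trans c d) x v)
         = ddir (chart_trans c d) x (\<phi> c x v))"

definition riemannian_metric ::
    "('p, 'e::euclidean_space) chart set \<Rightarrow> (('p, 'e) chart \<Rightarrow> 'e \<Rightarrow> 'e \<Rightarrow> 'e \<Rightarrow> real) \<Rightarrow> bool"
  where "riemannian_metric A g \<longleftrightarrow>
    (\<forall>c\<in>A. (\<forall>u v. smooth_on (chart_image c) (\<lambda>x. g c x u v)) \<and>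
       (\<forall>x\<in>chart_image c. bilinear (g c x) \<and> (\<forall>u v. g c x u v = g c x v u) \<and>
          (\<forall>v. v \<noteq> 0 \<longrightarrow> g c x v v > 0))) \<and>
    (\<forall>c\<in>A. \<forall>d\<in>A. \<forall>x\<in>chart_overlap c d. \<forall>u v.
       g d (chart_trans c d x) (ddir (chart_trans c d) x u) (ddir (chart_trans c d) x v)
         = g c x u v)"

definition integrable_structure ::
    "('p, 'e::euclidean_space) chart set \<Rightarrow> (('p, 'e) chart \<Rightarrow> 'e \<Rightarrow> 'e \<Rightarrow> 'e) \<Rightarrow> bool"
  where "integrable_structure A J \<longleftrightarrow>
    (\<forall>c\<in>A. \<forall>X Y. smooth_on (chart_image c) X \<longrightarrow> smooth_on (chart_image c) Y \<longrightarrow>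
       (\<forall>x\<in>chart_image c. nijenhuis (J c) X Y x = 0))"


section \<open>Metric contact pairs\<close>

definition contact_pair ::
    "('p, 'e::euclidean_space) chart set \<Rightarrow> nat \<Rightarrow> nat \<Rightarrow> (('p, 'e) chart \<Rightarrow> 'e \<Rightarrow> 'e \<Rightarrow> real)
      \<Rightarrow> (('p, 'e) chart \<Rightarrow> 'e \<Rightarrow> 'e \<Rightarrow> real) \<Rightarrow> bool"
  where "contact_pair A h k \<alpha>\<^sub>1 \<alpha>\<^sub>2 \<longleftrightarrow>
    one_form A \<alpha>\<^sub>1 \<and> one_form A \<alpha>\<^sub>2 \<and> DIM('e) = 2 * h + 2 * k + 2 \<and>
    (\<forall>c\<in>A. \<forall>x\<in>chart_image c.
       (let a1 = form1 (\<alpha>\<^sub>1 c x); a2 = form1 (\<alpha>\<^sub>2 c x);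
            b1 = form2 (ext_deriv (\<alpha>\<^sub>1 c) x); b2 = form2 (ext_deriv (\<alpha>\<^sub>2 c) x)
        in wedge 1 (2 * h + (1 + 2 * k)) a1
             (wedge (2 * h) (1 + 2 * k) (wedge_power 2 b1 h)
               (wedge 1 (2 * k) a2 (wedge_power 2 b2 k))) \<noteq> (\<lambda>v. 0) \<and>
           wedge_power 2 b1 (h + 1) = (\<lambda>v. 0) \<and>
           wedge_power 2 b2 (k + 1) = (\<lambda>v. 0)))"

definition reeb_fields ::
    "('p, 'e::euclidean_space) chart set \<Rightarrow> (('p, 'e) chart \<Rightarrow> 'e \<Rightarrow> 'e \<Rightarrow> real)
      \<Rightarrow> (('p, 'e) chart \<Rightarrow> 'e \<Rightarrow> 'e \<Rightarrow> real)
      \<Rightarrow> (('p, 'e) chart \<Rightarrow> 'e \<Rightarrow> 'e) \<Rightarrow> (('p, 'e) chart \<Rightarrow> 'e \<Rightarrow> 'e) \<Rightarrow> bool"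
  where "reeb_fields A \<alpha>\<^sub>1 \<alpha>\<^sub>2 Z\<^sub>1 Z\<^sub>2 \<longleftrightarrow>
    vector_field A Z\<^sub>1 \<and> vector_field A Z\<^sub>2 \<and>
    (\<forall>c\<in>A. \<forall>x\<in>chart_image c.
       \<alpha>\<^sub>1 c x (Z\<^sub>1 c x) = 1 \<and> \<alpha>\<^sub>1 c x (Z\<^sub>2 c x) = 0 \<and>
       \<alpha>\<^sub>2 c x (Z\<^sub>1 c x) = 0 \<and> \<alpha>\<^sub>2 c x (Z\<^sub>2 c x) = 1 \<and>
       (\<forall>v. ext_deriv (\<alpha>\<^sub>1 c) x (Z\<^sub>1 c x) v = 0 \<and> ext_deriv (\<alpha>\<^sub>2 c) x (Z\<^sub>1 c x) v = 0 \<and>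
            ext_deriv (\<alpha>\<^sub>1 c) x (Z\<^sub>2 c x) v = 0 \<and> ext_deriv (\<alpha>\<^sub>2 c) x (Z\<^sub>2 c x) v = 0))"

definition metric_contact_pair ::
    "('p, 'e::euclidean_space) chart set \<Rightarrow> nat \<Rightarrow> nat \<Rightarrow> (('p, 'e) chart \<Rightarrow> 'e \<Rightarrow> 'e \<Rightarrow> real)
      \<Rightarrow> (('p, 'e) chart \<Rightarrow> 'e \<Rightarrow> 'e \<Rightarrow> real)
      \<Rightarrow> (('p, 'e) chart \<Rightarrow> 'e \<Rightarrow> 'e) \<Rightarrow> (('p, 'e) chart \<Rightarrow> 'e \<Rightarrow> 'e)
      \<Rightarrow> (('p, 'e) chart \<Rightarrow> 'e \<Rightarrow> 'e \<Rightarrow> 'e) \<Rightarrow> (('p, 'e) chart \<Rightarrow> 'e \<Rightarrow> 'e \<Rightarrow> 'e \<Rightarrow> real) \<Rightarrow> bool"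
  where "metric_contact_pair A h k \<alpha>\<^sub>1 \<alpha>\<^sub>2 Z\<^sub>1 Z\<^sub>2 \<phi> g \<longleftrightarrow>
    contact_pair A h k \<alpha>\<^sub>1 \<alpha>\<^sub>2 \<and> reeb_fields A \<alpha>\<^sub>1 \<alpha>\<^sub>2 Z\<^sub>1 Z\<^sub>2 \<and>
    endomorphism_field A \<phi> \<and> riemannian_metric A g \<and>
    (\<forall>c\<in>A. \<forall>x\<in>chart_image c.
       \<phi> c x (Z\<^sub>1 c x) = 0 \<and> \<phi> c x (Z\<^sub>2 c x) = 0 \<and>
       (\<forall>v. \<phi> c x (\<phi> c x v) = - v + \<alpha>\<^sub>1 c x v *\<^sub>R Z\<^sub>1 c x + \<alpha>\<^sub>2 c x v *\<^sub>R Z\<^sub>2 c x) \<and>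
       (\<forall>u v. g c x u (\<phi> c x v) = ext_deriv (\<alpha>\<^sub>1 c) x u v + ext_deriv (\<alpha>\<^sub>2 c) x u v) \<and>
       (\<forall>v. g c x v (Z\<^sub>1 c x) = \<alpha>\<^sub>1 c x v \<and> g c x v (Z\<^sub>2 c x) = \<alpha>\<^sub>2 c x v))"

text \<open>Tangent space \<open>ker \<alpha> \<inter> ker d\<alpha>\<close> of the characteristic foliation.\<close>

definition char_distribution ::
    "('e::euclidean_space \<Rightarrow> 'e \<Rightarrow> real) \<Rightarrow> 'e \<Rightarrow> 'e set"
  where "char_distribution a x = {v. a x v = 0 \<and> (\<forall>w. ext_deriv a x v w = 0)}"

definition decomposable ::
    "('p, 'e::euclidean_space) chart set \<Rightarrow> (('p, 'e) chart \<Rightarrow> 'e \<Rightarrow> 'e \<Rightarrow> real)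
      \<Rightarrow> (('p, 'e) chart \<Rightarrow> 'e \<Rightarrow> 'e \<Rightarrow> real) \<Rightarrow> (('p, 'e) chart \<Rightarrow> 'e \<Rightarrow> 'e \<Rightarrow> 'e) \<Rightarrow> bool"
  where "decomposable A \<alpha>\<^sub>1 \<alpha>\<^sub>2 \<phi> \<longleftrightarrow>
    (\<forall>c\<in>A. \<forall>x\<in>chart_image c.
       \<phi> c x ` char_distribution (\<alpha>\<^sub>1 c) x \<subseteq> char_distribution (\<alpha>\<^sub>1 c) x \<and>
       \<phi> c x ` char_distribution (\<alpha>\<^sub>2 c) x \<subseteq> char_distribution (\<alpha>\<^sub>2 c) x)"

definition mcp_J ::
    "(('p, 'e::euclidean_space) chart \<Rightarrow> 'e \<Rightarrow> 'e \<Rightarrow> real) \<Rightarrow> (('p, 'e) chart \<Rightarrow> 'e \<Rightarrow> 'e \<Rightarrow> real)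
      \<Rightarrow> (('p, 'e) chart \<Rightarrow> 'e \<Rightarrow> 'e) \<Rightarrow> (('p, 'e) chart \<Rightarrow> 'e \<Rightarrow> 'e)
      \<Rightarrow> (('p, 'e) chart \<Rightarrow> 'e \<Rightarrow> 'e \<Rightarrow> 'e) \<Rightarrow> (('p, 'e) chart \<Rightarrow> 'e \<Rightarrow> 'e \<Rightarrow> 'e)"
  where "mcp_J \<alpha>\<^sub>1 \<alpha>\<^sub>2 Z\<^sub>1 Z\<^sub>2 \<phi> c x v =
    \<phi> c x v - \<alpha>\<^sub>2 c x v *\<^sub>R Z\<^sub>1 c x + \<alpha>\<^sub>1 c x v *\<^sub>R Z\<^sub>2 c x"


section \<open>Submanifolds\<close>

text \<open>A submanifold is a subset carrying its own topology and atlas for which the inclusion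
  is an immersion; the topology may be finer than the induced one, so embedded submanifolds are
  a special case.  For a chart \<open>d\<close> of \<open>N\<close> and a chart \<open>c\<close> of \<open>M\<close>, the inclusion is represented
  by \<open>chart_trans d c\<close>.\<close>

definition submanifold ::
    "'p topology \<Rightarrow> ('p, 'e::euclidean_space) chart set
      \<Rightarrow> 'p topology \<Rightarrow> ('p, 'f::euclidean_space) chart set \<Rightarrow> bool"
  where "submanifold T A S B \<longleftrightarrow>
    smooth_manifold S B \<and> continuous_map S T id \<and>
    (\<forall>d\<in>B. \<forall>c\<in>A. smooth_on (chart_overlap d c) (chart_trans d c) \<and>
       (\<forall>y\<in>chart_overlap d c. inj (ddir (chart_trans d c) y)))"

definition tangent_space ::
    "('p, 'f::euclidean_space) chart \<Rightarrow> ('p, 'e::euclidean_space) chart \<Rightarrow> 'f \<Rightarrow> 'e set"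
  where "tangent_space d c y = range (ddir (chart_trans d c) y)"

definition invariant_submanifold ::
    "('p, 'e::euclidean_space) chart set \<Rightarrow> ('p, 'f::euclidean_space) chart set
      \<Rightarrow> (('p, 'e) chart \<Rightarrow> 'e \<Rightarrow> 'e \<Rightarrow> 'e) \<Rightarrow> bool"
  where "invariant_submanifold A B J \<longleftrightarrow>
    (\<forall>d\<in>B. \<forall>c\<in>A. \<forall>y\<in>chart_overlap d c.
       J c (chart_trans d c y) ` tangent_space d c y \<subseteq> tangent_space d c y)"

definition tangent_to_submanifold ::
    "('p, 'e::euclidean_space) chart set \<Rightarrow> ('p, 'f::euclidean_space) chart set
      \<Rightarrow> (('p, 'e) chart \<Rightarrow> 'e \<Rightarrow> 'e) \<Rightarrow> bool"
  where "tangent_to_submanifold A B Z \<longleftrightarrow>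
    (\<forall>d\<in>B. \<forall>c\<in>A. \<forall>y\<in>chart_overlap d c. Z c (chart_trans d c y) \<in> tangent_space d c y)"

definition induced_metric ::
    "('e::euclidean_space \<Rightarrow> 'e \<Rightarrow> 'e \<Rightarrow> real) \<Rightarrow> ('f::euclidean_space \<Rightarrow> 'e)
      \<Rightarrow> 'f \<Rightarrow> 'f \<Rightarrow> 'f \<Rightarrow> real"
  where "induced_metric g f y u w = g (f y) (ddir f y u) (ddir f y w)"

text \<open>The trace does not depend on the orthonormal basis, and such bases exist
  (\<open>orthonormal_basis_exists\<close> below).\<close>

definition minimal_submanifold ::
    "('p, 'e::euclidean_space) chart set \<Rightarrow> ('p, 'f::euclidean_space) chart set
      \<Rightarrow> (('p, 'e) chart \<Rightarrow> 'e \<Rightarrow> 'e \<Rightarrow> 'e \<Rightarrow> real) \<Rightarrow> bool"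
  where "minimal_submanifold A B g \<longleftrightarrow>
    (\<forall>d\<in>B. \<forall>c\<in>A. \<forall>y\<in>chart_overlap d c. \<forall>E.
       orthonormal_basis (induced_metric (g c) (chart_trans d c) y) E \<longrightarrow>
       (\<Sum>e\<in>E. second_fundamental_form (g c) (chart_trans d c) y e e) = 0)"


section \<open>Well-definedness of the pointwise constructions\<close>

lemma ddir_field:
  fixes a :: "'e::euclidean_space \<Rightarrow> 'e \<Rightarrow> real"
  assumes S: "open S" "x \<in> S" and lin: "\<And>z. z \<in> S \<Longrightarrow> linear (a z)"
    and da: "\<And>v. (\<lambda>z. a z v) differentiable (at x)" and dY: "Y differentiable (at x)"
  shows "ddir (\<lambda>z. a z (Y z)) x u = ddir (\<lambda>z. a z (Y x)) x u + a x (ddir Y x u)"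
proof -
  have expand: "a z w = (\<Sum>b\<in>Basis. (w \<bullet> b) * a z b)" if "z \<in> S" for z w
  proof -
    have "a z w = a z (\<Sum>b\<in>Basis. (w \<bullet> b) *\<^sub>R b)" by (simp add: euclidean_representation)
    also have "\<dots> = (\<Sum>b\<in>Basis. (w \<bullet> b) * a z b)"
      by (simp add: linear_sum[OF lin[OF that]] linear_cmul[OF lin[OF that]])
    finally show ?thesis .
  qed
  have Da: "((\<lambda>z. a z v) has_derivative ddir (\<lambda>z. a z v) x) (at x)" for v
    using da frechet_derivative_works by blast
  have DY: "(Y has_derivative ddir Y x) (at x)"
    using dY frechet_derivative_works by blast
  have "((\<lambda>z. \<Sum>b\<in>Basis. (Y z \<bullet> b) * a z b) has_derivative
      (\<lambda>u. \<Sum>b\<in>Basis. (Y x \<bullet> b) * ddir (\<lambda>z. a z b) x u + (ddir Y x u \<bullet> b) * a x b)) (at x)"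
    by (intro has_derivative_sum has_derivative_mult has_derivative_inner_left DY Da)
  then have 1: "((\<lambda>z. a z (Y z)) has_derivative
      (\<lambda>u. \<Sum>b\<in>Basis. (Y x \<bullet> b) * ddir (\<lambda>z. a z b) x u + (ddir Y x u \<bullet> b) * a x b)) (at x)"
    by (rule has_derivative_transform_within_open[OF _ S]) (simp add: expand[symmetric])
  have "((\<lambda>z. \<Sum>b\<in>Basis. (Y x \<bullet> b) * a z b) has_derivative
      (\<lambda>u. \<Sum>b\<in>Basis. (Y x \<bullet> b) * ddir (\<lambda>z. a z b) x u)) (at x)"
    by (intro has_derivative_sum has_derivative_mult_right Da)
  then have 2: "((\<lambda>z. a z (Y x)) has_derivative
      (\<lambda>u. \<Sum>b\<in>Basis. (Y x \<bullet> b) * ddir (\<lambda>z. a z b) x u)) (at x)"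
    by (rule has_derivative_transform_within_open[OF _ S]) (simp add: expand[symmetric])
  show ?thesis
    by (simp add: frechet_derivative_at[OF 1, symmetric] frechet_derivative_at[OF 2, symmetric]
        expand[OF S(2), of "ddir Y x u"] sum.distrib)
qed

lemma ext_deriv_eq_fields:
  fixes a :: "'e::euclidean_space \<Rightarrow> 'e \<Rightarrow> real"
  assumes S: "open S" "x \<in> S" and lin: "\<And>z. z \<in> S \<Longrightarrow> linear (a z)"
    and da: "\<And>v. (\<lambda>z. a z v) differentiable (at x)"
    and dX: "X differentiable (at x)" and dY: "Y differentiable (at x)"
  shows "ext_deriv a x (X x) (Y x) = ext_deriv_fields a X Y x"
  unfolding ext_deriv_def ext_deriv_fields_def lie_bracket_def
  using ddir_field[OF S lin da dX, of "Y x"] ddir_field[OF S lin da dY, of "X x"]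
    linear_0[OF lin[OF S(2)]] linear_diff[OF lin[OF S(2)]]
  by (simp add: frechet_derivative_const)

lemma orthonormal_basis_exists:
  fixes h :: "'f::euclidean_space \<Rightarrow> 'f \<Rightarrow> real"
  assumes bil: "bilinear h" and sym: "\<And>u v. h u v = h v u" and pos: "\<And>v. v \<noteq> 0 \<Longrightarrow> h v v > 0"
  shows "\<exists>E. orthonormal_basis h E"
proof -
  have "\<exists>E. finite E \<and> card E = n \<and> (\<forall>e\<in>E. \<forall>e'\<in>E. h e e' = (if e = e' then 1 else 0))"
    if "n \<le> DIM('f)" for n
    using that
  proof (induction n)
    case 0
    then show ?case by (intro exI[of _ "{}"]) simp
  next
    case (Suc n)
    then obtain E where E: "finite E" "card E = n"
        "\<And>e e'. e \<in> E \<Longrightarrow> e' \<in> E \<Longrightarrow> h e e' = (if e = e' then 1 else 0)"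
      by auto
    have "dim (span E) < DIM('f)"
      using dim_le_card'[OF E(1)] E(2) Suc.prems by simp
    then obtain v where v: "v \<notin> span E"
      by (metis UNIV_eq_I dim_UNIV less_irrefl)
    define w where "w = v - (\<Sum>e\<in>E. h v e *\<^sub>R e)"
    have "w \<noteq> 0"
    proof
      assume "w = 0"
      then have "v = (\<Sum>e\<in>E. h v e *\<^sub>R e)" by (simp add: w_def)
      also have "\<dots> \<in> span E" by (intro span_sum span_scale span_base)
      finally show False using v by blast
    qed
    have lin: "linear (\<lambda>u. h u z)" for z using bil by (simp add: bilinear_def)
    have orth: "h w e = 0" if "e \<in> E" for e
    proof -
      have "h w e = h v e - (\<Sum>e'\<in>E. h v e' * h e' e)"
        unfolding w_def by (simp add: linear_diff[OF lin] linear_sum[OF lin] linear_cmul[OF lin])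
      also have "(\<Sum>e'\<in>E. h v e' * h e' e) = (\<Sum>e'\<in>E. if e' = e then h v e else 0)"
        by (rule sum.cong) (auto simp: E(3) that)
      finally show ?thesis using E(1) that by simp
    qed
    define f where "f = (1 / sqrt (h w w)) *\<^sub>R w"
    have f: "h f f = 1" "h f e = 0" "h e f = 0" if "e \<in> E" for e
      using pos[OF \<open>w \<noteq> 0\<close>] orth that sym[of e w]
      by (simp_all add: f_def bilinear_lmul[OF bil] bilinear_rmul[OF bil])
    have ff: "h f f = 1"
      using pos[OF \<open>w \<noteq> 0\<close>] by (simp add: f_def bilinear_lmul[OF bil] bilinear_rmul[OF bil])
    have "f \<notin> E" using f(2) ff by force
    then show ?case
      using E f ff by (intro exI[of _ "insert f E"]) auto
  qed
  from this[OF order_refl] obtain E where E: "finite E" "card E = DIM('f)"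
      "\<And>e e'. e \<in> E \<Longrightarrow> e' \<in> E \<Longrightarrow> h e e' = (if e = e' then 1 else 0)"
    by auto
  have "independent E"
  proof (rule independent_if_scalars_zero[OF E(1)])
    fix r e
    assume s: "(\<Sum>x\<in>E. r x *\<^sub>R x) = 0" and e: "e \<in> E"
    have lin: "linear (\<lambda>u. h u e)" using bil by (simp add: bilinear_def)
    have "0 = h (\<Sum>x\<in>E. r x *\<^sub>R x) e" using s bilinear_lzero[OF bil] by simp
    also have "\<dots> = (\<Sum>x\<in>E. r x * h x e)" by (simp add: linear_sum[OF lin] linear_cmul[OF lin])
    also have "\<dots> = (\<Sum>x\<in>E. if x = e then r e else 0)"
      by (rule sum.cong) (auto simp: E(3) e)
    finally show "r e = 0" using E(1) e by simp
  qed
  then have "span E = UNIV"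
    using E(2) card_ge_dim_independent[of E UNIV] by (auto simp: dim_UNIV)
  then show ?thesis using E unfolding orthonormal_basis_def by auto
qed

lemma christoffel_exists_unique:
  fixes g :: "'e::euclidean_space \<Rightarrow> 'e \<Rightarrow> 'e \<Rightarrow> real"
  assumes S: "open S" "x \<in> S"
    and bil: "\<And>y. y \<in> S \<Longrightarrow> bilinear (g y)" and sym: "\<And>u v. g x u v = g x v u"
    and pos: "\<And>v. v \<noteq> 0 \<Longrightarrow> g x v v > 0"
    and dg: "\<And>u v. (\<lambda>y. g y u v) differentiable (at x)"
  shows "\<exists>!w. \<forall>z. g x w z =
    1/2 * (ddir (\<lambda>y. g y v z) x u + ddir (\<lambda>y. g y u z) x v - ddir (\<lambda>y. g y u v) x z)"
    (is "\<exists>!w. \<forall>z. g x w z = ?R z")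
proof -
  have D: "((\<lambda>y. g y p q) has_derivative ddir (\<lambda>y. g y p q) x) (at x)" for p q
    using dg frechet_derivative_works by blast
  have add: "ddir (\<lambda>y. g y p (q + r)) x t = ddir (\<lambda>y. g y p q) x t + ddir (\<lambda>y. g y p r) x t"
    for p q r t
  proof -
    have "((\<lambda>y. g y p (q + r)) has_derivative
        (\<lambda>t. ddir (\<lambda>y. g y p q) x t + ddir (\<lambda>y. g y p r) x t)) (at x)"
      by (rule has_derivative_transform_within_open[OF has_derivative_add[OF D D] S])
        (simp add: bilinear_radd[OF bil])
    from frechet_derivative_at[OF this] show ?thesis by metis
  qed
  have scale: "ddir (\<lambda>y. g y p (s *\<^sub>R q)) x t = s * ddir (\<lambda>y. g y p q) x t" for p q s t
  proof -
    have "((\<lambda>y. g y p (s *\<^sub>R q)) has_derivative (\<lambda>t. s * ddir (\<lambda>y. g y p q) x t)) (at x)"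
      by (rule has_derivative_transform_within_open[OF has_derivative_mult_right[OF D] S])
        (simp add: bilinear_rmul[OF bil])
    from frechet_derivative_at[OF this] show ?thesis by metis
  qed
  have lin: "linear (ddir (\<lambda>y. g y p q) x)" for p q
    using D has_derivative_linear by blast
  have R: "linear ?R"
    by (rule linearI) (simp_all add: add scale linear_add[OF lin] linear_cmul[OF lin] algebra_simps)
  obtain E where E: "finite E" "span E = UNIV"
      "\<And>e e'. e \<in> E \<Longrightarrow> e' \<in> E \<Longrightarrow> g x e e' = (if e = e' then 1 else 0)"
    using orthonormal_basis_exists[OF bil[OF S(2)] sym pos] unfolding orthonormal_basis_def by blast
  define w where "w = (\<Sum>e\<in>E. ?R e *\<^sub>R e)"
  have bx: "bilinear (g x)" by (rule bil[OF S(2)])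
  have linl: "linear (\<lambda>u. g x u z)" and linr: "linear (g x z)" for z
    using bx by (simp_all add: bilinear_def)
  have w: "g x w z = ?R z" for z
  proof (rule linear_eq_on_span[OF linr R])
    show "z \<in> span E" using E(2) by simp
    fix e assume e: "e \<in> E"
    have "g x w e = (\<Sum>e'\<in>E. ?R e' * g x e' e)"
      unfolding w_def by (simp add: linear_sum[OF linl] linear_cmul[OF linl])
    also have "\<dots> = (\<Sum>e'\<in>E. if e' = e then ?R e else 0)"
      by (rule sum.cong) (auto simp: E(3) e)
    finally show "g x w e = ?R e" using E(1) e by simp
  qed
  show ?thesis
  proof (rule ex1I[of _ w])
    show "\<forall>z. g x w z = ?R z" using w by blast
    fix w' assume "\<forall>z. g x w' z = ?R z"
    then have "g x w' (w' - w) = g x w (w' - w)" by (metis w)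
    then have "g x (w' - w) (w' - w) = 0" by (simp add: linear_diff[OF linl])
    then show "w' = w" using pos[of "w' - w"] by fastforce
  qed
qed

lemma normal_part_exists_unique:
  fixes h :: "'e::euclidean_space \<Rightarrow> 'e \<Rightarrow> real" and L :: "'f::euclidean_space \<Rightarrow> 'e"
  assumes bil: "bilinear h" and sym: "\<And>u v. h u v = h v u" and pos: "\<And>v. v \<noteq> 0 \<Longrightarrow> h v v > 0"
    and L: "linear L" "inj L"
  shows "\<exists>!n. v - n \<in> range L \<and> (\<forall>w\<in>range L. h n w = 0)"
proof -
  have linl: "linear (\<lambda>u. h u z)" and linr: "linear (h z)" for z
    using bil by (simp_all add: bilinear_def)
  have "bilinear (\<lambda>u w. h (L u) (L w))"
    unfolding bilinear_def using linear_compose[OF L(1) linl] linear_compose[OF L(1) linr]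
    by (simp add: o_def)
  moreover have "h (L u) (L u) > 0" if "u \<noteq> 0" for u
    using pos that L by (metis injD linear_0)
  ultimately obtain E where E: "finite E" "span E = UNIV"
      "\<And>e e'. e \<in> E \<Longrightarrow> e' \<in> E \<Longrightarrow> h (L e) (L e') = (if e = e' then 1 else 0)"
    using orthonormal_basis_exists[of "\<lambda>u w. h (L u) (L w)"] sym
    unfolding orthonormal_basis_def by blast
  define n where "n = v - L (\<Sum>e\<in>E. h v (L e) *\<^sub>R e)"
  have n: "h n (L u) = 0" for u
  proof (rule linear_eq_on_span[OF linear_compose[OF L(1) linr, unfolded o_def] linear_zero])
    show "u \<in> span E" using E(2) by simp
    fix e assume e: "e \<in> E"
    have "h n (L e) = h v (L e) - (\<Sum>e'\<in>E. h v (L e') * h (L e') (L e))"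
      unfolding n_def
      by (simp add: linear_diff[OF linl] linear_sum[OF L(1)] linear_cmul[OF L(1)]
          linear_sum[OF linl] linear_cmul[OF linl])
    also have "(\<Sum>e'\<in>E. h v (L e') * h (L e') (L e)) = (\<Sum>e'\<in>E. if e' = e then h v (L e) else 0)"
      by (rule sum.cong) (auto simp: E(3) e)
    finally show "h n (L e) = 0" using E(1) e by simp
  qed
  show ?thesis
  proof (rule ex1I[of _ n])
    show "v - n \<in> range L \<and> (\<forall>w\<in>range L. h n w = 0)"
      using n by (auto simp: n_def)
    fix m assume m: "v - m \<in> range L \<and> (\<forall>w\<in>range L. h m w = 0)"
    then obtain a where a: "v - m = L a" by blast
    have "m - n = L ((\<Sum>e\<in>E. h v (L e) *\<^sub>R e) - a)"
      using a by (simp add: n_def linear_diff[OF L(1)] algebra_simps)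
    then have "h m (m - n) = 0" "h n (m - n) = 0" using m n by simp_all
    then have "h (m - n) (m - n) = 0" by (simp add: linear_diff[OF linl])
    then show "m = n" using pos[of "m - n"] by fastforce
  qed
qed

end

theory Submission
  imports Defs
begin

text \<open>
  The equivalence holds at each single point of \<open>N\<close>. For any almost Hermitian
  \<open>(g, J)\<close> with \<open>\<Omega>(X, Y) = g(X, JY)\<close> and any \<open>J\<close>-invariant submanifold, a normal vector \<open>V\<close> and a tangent
  vector \<open>X\<close> satisfy \<open>g(II(X, X) + II(JX, JX), V) = d\<Omega>(X, JX, V)\<close>. Here
  \<open>\<Omega> = d\<alpha>\<^sub>1 + d\<alpha>\<^sub>2\<close> up to the term \<open>\<alpha>\<^sub>1 \<and> \<alpha>\<^sub>2\<close>, so the trace \<open>H\<close> of \<open>II\<close> satisfies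
  \<open>g(H, V) = \<alpha>\<^sub>1(V) A\<^sub>2 - \<alpha>\<^sub>2(V) A\<^sub>1 - 2 d\<alpha>\<^sub>1(V, Z\<^sub>1\<^sup>T) - 2 d\<alpha>\<^sub>2(V, Z\<^sub>2\<^sup>T)\<close>, where
  \<open>A\<^sub>i = \<Sum> d\<alpha>\<^sub>i(e, \<phi>e)\<close> over an orthonormal frame and \<open>T\<close> denotes the tangential part. Everything
  vanishes when \<open>Z\<^sub>1\<close> and \<open>Z\<^sub>2\<close> are tangent.

  Conversely, decomposability gives \<open>d\<alpha>\<^sub>i(X, \<phi>X) \<le> 0\<close>, and taking for \<open>V\<close> the normal parts
  of \<open>Z\<^sub>1\<close> and \<open>Z\<^sub>2\<close> makes the nonzero terms of \<open>g(H, V)\<close> have the same sign. So if \<open>H = 0\<close> and \<open>Z\<^sub>1\<close> is not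
  tangent, then \<open>A\<^sub>1 = A\<^sub>2 = 0\<close>, hence \<open>\<phi>\<close> vanishes on the tangent space, which must then
  be spanned by \<open>Z\<^sub>1\<close> and \<open>Z\<^sub>2\<close>: a contradiction.
\<close>

section \<open>Powers of 2-forms\<close>

text \<open>The standard symplectic form, for the symplectic pairs of indices \<open>(0, 1), (2, 3), \<dots>\<close>\<close>

definition pair_form :: "nat \<Rightarrow> nat \<Rightarrow> real"
  where "pair_form i j = (if i div 2 = j div 2 then real (j mod 2) - real (i mod 2) else 0)"

text \<open>A term is nonzero only if \<open>\<sigma>\<close> maps symplectic pairs of indices to
  such pairs. Then \<open>\<sigma>\<close> is a permutation of pairs, which is even, combined with
  flips inside pairs, and each flip reverses both the sign of \<open>\<sigma>\<close> and the sign
  of one factor. The induction moves the image of the last pair back into place.\<close>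

lemma pair_form_permutes_nonneg:
  assumes "\<sigma> permutes {..<2 * n}"
  shows "0 \<le> of_int (sign \<sigma>) * (\<Prod>i<n. pair_form (\<sigma> (2 * i)) (\<sigma> (2 * i + 1)))"
  using assms
proof (induction n arbitrary: \<sigma>)
  case 0
  then show ?case by simp
next
  case (Suc n)
  define q where "q \<sigma> = of_int (sign \<sigma>) * (\<Prod>i<Suc n. pair_form (\<sigma> (2 * i)) (\<sigma> (2 * i + 1)))"
    for \<sigma> :: "nat \<Rightarrow> nat"
  have fixed: "0 \<le> q \<tau>"
    if \<tau>: "\<tau> permutes {..<2 * Suc n}" and fixes_last: "\<tau> (2 * n) = 2 * n" "\<tau> (2 * n + 1) = 2 * n + 1" for \<tau>
  proof -
    have "\<tau> permutes {..<2 * n}"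
    proof (rule permutes_superset[OF \<tau>])
      fix x assume "x \<in> {..<2 * Suc n} - {..<2 * n}"
      then have "x = 2 * n \<or> x = 2 * n + 1" by auto
      then show "\<tau> x = x" using fixes_last by auto
    qed
    then show ?thesis using Suc.IH[of \<tau>] fixes_last by (simp add: q_def pair_form_def)
  qed
  have block: "0 \<le> q \<tau>"
    if \<tau>: "\<tau> permutes {..<2 * Suc n}"
      and ac: "\<tau> (2 * n) div 2 = n" "\<tau> (2 * n + 1) div 2 = n" for \<tau>
  proof -
    have inj: "\<tau> x \<noteq> \<tau> y" if "x \<noteq> y" for x y using permutes_inj[OF \<tau>] that by (auto simp: inj_def)
    have "\<tau> (2 * n) \<noteq> \<tau> (2 * n + 1)" by (rule inj) simp
    then consider "\<tau> (2 * n) = 2 * n" "\<tau> (2 * n + 1) = 2 * n + 1"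
      | "\<tau> (2 * n) = 2 * n + 1" "\<tau> (2 * n + 1) = 2 * n"
      using ac by linarith
    then show ?thesis
    proof cases
      case 1
      then show ?thesis using fixed[OF \<tau>] by simp
    next
      case 2
      \<comment> \<open>Undoing the flip reverses the sign of the permutation and of the last
        factor, so \<open>q\<close> keeps its value.\<close>
      let ?s = "Transposition.transpose (2 * n) (2 * n + 1)"
      have s: "?s permutes {..<2 * Suc n}" by (rule permutes_swap_id) auto
      have "permutation ?s" "permutation \<tau>"
        using s \<tau> permutation_permutes by blast+
      then have sg: "sign (?s \<circ> \<tau>) = - sign \<tau>" by (simp add: sign_compose sign_swap_id)
      have "?s (\<tau> j) = \<tau> j" if "j < 2 * n" for j
      proof -
        have "\<tau> j \<noteq> 2 * n" "\<tau> j \<noteq> 2 * n + 1" using inj[of j "2 * n + 1"] inj[of j "2 * n"] 2 that by auto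
        then show ?thesis by (simp add: transpose_def)
      qed
      then have "(\<Prod>i<n. pair_form ((?s \<circ> \<tau>) (2 * i)) ((?s \<circ> \<tau>) (2 * i + 1)))
        = (\<Prod>i<n. pair_form (\<tau> (2 * i)) (\<tau> (2 * i + 1)))"
        by (intro prod.cong) auto
      then have "q (?s \<circ> \<tau>) = q \<tau>"
        using 2 sg by (simp add: q_def pair_form_def)
      moreover have "0 \<le> q (?s \<circ> \<tau>)"
        by (rule fixed[OF permutes_compose[OF \<tau> s]]) (use 2 in \<open>simp_all\<close>)
      ultimately show ?thesis by simp
    qed
  qed
  show ?case
  proof (cases "\<sigma> (2 * n) div 2 = \<sigma> (2 * n + 1) div 2")
    case False
    then show ?thesis by (simp add: pair_form_def)
  next
    case True
    define t where "t = \<sigma> (2 * n) div 2"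
    have t: "t \<le> n"
      using permutes_in_image[OF Suc.prems, of "2 * n"] by (simp add: t_def)
    \<comment> \<open>\<open>\<rho>\<close> exchanges the pair with index \<open>t\<close> and the
      last pair. It is a product of two transpositions, hence even, or the identity if
      \<open>t = n\<close>.\<close>
    have "\<exists>\<rho>. \<rho> permutes {..<2 * Suc n} \<and> sign \<rho> = 1 \<and>
        (\<forall>i j. pair_form (\<rho> i) (\<rho> j) = pair_form i j) \<and> (\<forall>i. i div 2 = t \<longrightarrow> \<rho> i div 2 = n)"
    proof (cases "t = n")
      case True
      then show ?thesis by (intro exI[of _ id]) (simp add: permutes_id)
    next
      case False
      let ?r = "Transposition.transpose (2 * t) (2 * n) \<circ> Transposition.transpose (2 * t + 1) (2 * n + 1)"
      have p: "Transposition.transpose (2 * t) (2 * n) permutes {..<2 * Suc n}"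
        "Transposition.transpose (2 * t + 1) (2 * n + 1) permutes {..<2 * Suc n}"
        using t by (auto intro!: permutes_swap_id)
      then have "sign ?r = 1"
        using False by (simp add: sign_compose sign_swap_id permutation_swap_id)
      moreover have r: "?r i = (if i div 2 = t then 2 * n + i mod 2
          else if i div 2 = n then 2 * t + i mod 2 else i)" for i
      proof -
        have "i = 2 * (i div 2) \<or> i = 2 * (i div 2) + 1" by presburger
        then obtain l where "i = 2 * l \<or> i = 2 * l + 1" by blast
        then show ?thesis using False by (auto simp: transpose_def)
      qed
      have "?r i mod 2 = i mod 2" "?r i div 2 = Transposition.transpose t n (i div 2)" for i
        unfolding r by (auto simp: transpose_def)
      then have "pair_form (?r i) (?r j) = pair_form i j" for i j
        unfolding pair_form_def by (metis transpose_involutory)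
      moreover have "?r i div 2 = n" if "i div 2 = t" for i
        unfolding r using that by simp
      ultimately show ?thesis
        using permutes_compose[OF p(2,1)] by blast
    qed
    then obtain \<rho> where \<rho>: "\<rho> permutes {..<2 * Suc n}" "sign \<rho> = 1"
      "\<And>i j. pair_form (\<rho> i) (\<rho> j) = pair_form i j" "\<And>i. i div 2 = t \<Longrightarrow> \<rho> i div 2 = n"
      by blast
    have "permutation \<rho>" "permutation \<sigma>" using \<rho>(1) Suc.prems permutation_permutes by blast+
    then have "q (\<rho> \<circ> \<sigma>) = q \<sigma>" using \<rho>(2,3) by (simp add: q_def sign_compose)
    moreover have "0 \<le> q (\<rho> \<circ> \<sigma>)"
      by (rule block[OF permutes_compose[OF Suc.prems \<rho>(1)]]) (use True in \<open>simp_all add: \<rho>(4) t_def\<close>)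
    ultimately show ?thesis by (simp add: q_def)
  qed
qed

text \<open>For skew \<open>b\<close> this is \<open>2 ^ n * fact n\<close> times the Pfaffian of
  the matrix with entries \<open>b (v i) (v j)\<close>.\<close>

definition pairing_sum :: "('e \<Rightarrow> 'e \<Rightarrow> real) \<Rightarrow> nat \<Rightarrow> (nat \<Rightarrow> 'e) \<Rightarrow> real"
  where "pairing_sum b n v = (\<Sum>\<sigma> | \<sigma> permutes {..<2 * n}.
    of_int (sign \<sigma>) * (\<Prod>i<n. b (v (\<sigma> (2 * i))) (v (\<sigma> (2 * i + 1)))))"

text \<open>One more wedge factor produces a double sum over outer and inner permutations. An inner
  permutation can be absorbed into the outer one, so each term is counted
  \<open>fact (2 * n)\<close> times. Later arguments use only the sign of the constant.\<close>

lemma wedge_power_form2: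
  "\<exists>c>0. \<forall>v. wedge_power 2 (form2 b) n v = c * pairing_sum b n v"
proof (induction n)
  case 0
  show ?case by (rule exI[of _ 1]) (simp add: pairing_sum_def)
next
  case (Suc n)
  then obtain c where c: "c > 0" "\<And>v. wedge_power 2 (form2 b) n v = c * pairing_sum b n v" by blast
  let ?P = "{\<sigma>. \<sigma> permutes {..<2 * Suc n}}" and ?Q = "{\<tau>. \<tau> permutes {..<2 * n}}"
  \<comment> \<open>\<open>shift \<tau>\<close> fixes 0 and 1 and acts as \<open>\<tau>\<close> on
    the indices moved up by 2, which are those that \<open>wedge\<close> hands to its second
    factor.\<close>
  define shift where "shift = map_permutation {..<2 * n} (\<lambda>i. 2 + i)"
  have shift: "shift \<tau> \<in> ?P" "sign (shift \<tau>) = sign \<tau>" "shift \<tau> 0 = 0" "shift \<tau> 1 = 1"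
    "\<And>i. i < 2 * n \<Longrightarrow> shift \<tau> (2 + i) = 2 + \<tau> i" if "\<tau> \<in> ?Q" for \<tau>
  proof -
    have \<tau>: "\<tau> permutes {..<2 * n}" using that by simp
    have "shift \<tau> permutes (\<lambda>i. 2 + i) ` {..<2 * n}"
      unfolding shift_def by (rule map_permutation_permutes) (use \<tau> in \<open>auto simp: bij_betw_def inj_on_def\<close>)
    then show "shift \<tau> \<in> ?P" by (auto elim!: permutes_subset)
    show "shift \<tau> 0 = 0" "shift \<tau> 1 = 1"
      by (auto simp: shift_def map_permutation_def restrict_id_def)
    show "sign (shift \<tau>) = sign \<tau>"
      unfolding shift_def by (rule sign_map_permutation) (use \<tau> in \<open>auto simp: inj_on_def\<close>)
    show "shift \<tau> (2 + i) = 2 + \<tau> i" if "i < 2 * n" for i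
      using map_permutation_apply[of "\<lambda>i. 2 + i" "{..<2 * n}" i \<tau>] that by (simp add: shift_def inj_on_def)
  qed
  have perm: "permutation \<sigma>" if "\<sigma> \<in> ?P" for \<sigma>
    using that permutation_permutes by auto
  have key: "(\<Sum>\<sigma>\<in>?P. of_int (sign \<sigma>) * b (v (\<sigma> 0)) (v (\<sigma> 1)) * pairing_sum b n (\<lambda>i. v (\<sigma> (2 + i))))
    = fact (2 * n) * pairing_sum b (Suc n) v" for v
  proof -
    define G where "G \<sigma> = of_int (sign \<sigma>) * (\<Prod>i<Suc n. b (v (\<sigma> (2 * i))) (v (\<sigma> (2 * i + 1))))"
      for \<sigma> :: "nat \<Rightarrow> nat"
    have G: "of_int (sign \<sigma>) * b (v (\<sigma> 0)) (v (\<sigma> 1)) *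
        (of_int (sign \<tau>) * (\<Prod>i<n. b (v (\<sigma> (2 + \<tau> (2 * i)))) (v (\<sigma> (2 + \<tau> (2 * i + 1))))))
      = G (\<sigma> \<circ> shift \<tau>)" if "\<sigma> \<in> ?P" "\<tau> \<in> ?Q" for \<sigma> \<tau>
    proof -
      have "(\<Prod>i<n. b (v (\<sigma> (2 + \<tau> (2 * i)))) (v (\<sigma> (2 + \<tau> (2 * i + 1)))))
        = (\<Prod>i<n. b (v ((\<sigma> \<circ> shift \<tau>) (2 * Suc i))) (v ((\<sigma> \<circ> shift \<tau>) (2 * Suc i + 1))))"
      proof (rule prod.cong[OF refl])
        fix i assume "i \<in> {..<n}"
        then show "b (v (\<sigma> (2 + \<tau> (2 * i)))) (v (\<sigma> (2 + \<tau> (2 * i + 1))))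
          = b (v ((\<sigma> \<circ> shift \<tau>) (2 * Suc i))) (v ((\<sigma> \<circ> shift \<tau>) (2 * Suc i + 1)))"
          using shift(5)[OF that(2), of "2 * i"] shift(5)[OF that(2), of "2 * i + 1"] by simp
      qed
      then show ?thesis
        using shift(3,4)[OF that(2)] sign_compose[OF perm[OF that(1)] perm[OF shift(1)[OF that(2)]]]
        unfolding G_def
        by (simp add: shift(2)[OF that(2)] prod.lessThan_Suc_shift del: prod.lessThan_Suc)
    qed
    have "(\<Sum>\<sigma>\<in>?P. of_int (sign \<sigma>) * b (v (\<sigma> 0)) (v (\<sigma> 1)) * pairing_sum b n (\<lambda>i. v (\<sigma> (2 + i))))
      = (\<Sum>\<sigma>\<in>?P. \<Sum>\<tau>\<in>?Q. G (\<sigma> \<circ> shift \<tau>))"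
      unfolding pairing_sum_def sum_distrib_left by (intro sum.cong refl G) auto
    also have "\<dots> = (\<Sum>\<tau>\<in>?Q. \<Sum>\<sigma>\<in>?P. G (\<sigma> \<circ> shift \<tau>))" by (rule sum.swap)
    \<comment> \<open>Right composition with \<open>shift \<tau>\<close> is a bijection of
      \<open>?P\<close>, so the inner sum does not depend on \<open>\<tau>\<close>.\<close>
    also have "\<dots> = (\<Sum>\<tau>\<in>?Q. \<Sum>\<sigma>\<in>?P. G \<sigma>)"
    proof (rule sum.cong[OF refl])
      fix \<tau> assume "\<tau> \<in> ?Q"
      then have "shift \<tau> permutes {..<2 * Suc n}" using shift(1) by blast
      from sum_permutations_compose_right[OF this, of G, symmetric]
      show "(\<Sum>\<sigma>\<in>?P. G (\<sigma> \<circ> shift \<tau>)) = (\<Sum>\<sigma>\<in>?P. G \<sigma>)" .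
    qed
    also have "\<dots> = fact (2 * n) * pairing_sum b (Suc n) v"
      using card_permutations[of "{..<2 * n}" "2 * n"] by (simp add: pairing_sum_def G_def)
    finally show ?thesis .
  qed
  have "wedge_power 2 (form2 b) (Suc n) v = c * fact (2 * n) / fact (2 * Suc n) * pairing_sum b (Suc n) v" for v
  proof -
    have "wedge_power 2 (form2 b) (Suc n) v
      = c * (\<Sum>\<sigma>\<in>?P. of_int (sign \<sigma>) * b (v (\<sigma> 0)) (v (\<sigma> 1)) * pairing_sum b n (\<lambda>i. v (\<sigma> (2 + i))))
        / fact (2 * Suc n)"
      by (simp add: wedge_def form2_def c(2) sum_distrib_left mult.commute mult.left_commute)
    then show ?thesis unfolding key by simp
  qed
  then show ?case using c(1) by (intro exI[of _ "c * fact (2 * n) / fact (2 * Suc n)"]) simp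
qed

section \<open>Symplectic families and the rank of a 2-form\<close>

definition symplectic_family :: "('e \<Rightarrow> 'e \<Rightarrow> real) \<Rightarrow> (nat \<Rightarrow> 'e) \<Rightarrow> nat \<Rightarrow> bool"
  where "symplectic_family b e n \<longleftrightarrow> (\<forall>i<2 * n. \<forall>j<2 * n. b (e i) (e j) = pair_form i j)"

text \<open>No cancellation can occur in the pairing sum: every term is nonnegative, and the
  identity contributes 1.\<close>

lemma wedge_power_symplectic_family:
  assumes "symplectic_family b e n"
  shows "wedge_power 2 (form2 b) n e > 0"
proof -
  have eq: "(\<Prod>i<n. b (e (\<sigma> (2 * i))) (e (\<sigma> (2 * i + 1)))) = (\<Prod>i<n. pair_form (\<sigma> (2 * i)) (\<sigma> (2 * i + 1)))"
    if \<sigma>: "\<sigma> permutes {..<2 * n}" for \<sigma>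
  proof (rule prod.cong[OF refl])
    fix i assume "i \<in> {..<n}"
    then have "\<sigma> (2 * i) < 2 * n" "\<sigma> (2 * i + 1) < 2 * n"
      using permutes_in_image[OF \<sigma>, of "2 * i"] permutes_in_image[OF \<sigma>, of "2 * i + 1"] by auto
    then show "b (e (\<sigma> (2 * i))) (e (\<sigma> (2 * i + 1))) = pair_form (\<sigma> (2 * i)) (\<sigma> (2 * i + 1))"
      using assms unfolding symplectic_family_def by blast
  qed
  let ?q = "\<lambda>\<sigma>. of_int (sign \<sigma>) * (\<Prod>i<n. pair_form (\<sigma> (2 * i)) (\<sigma> (2 * i + 1)))"
  have "pairing_sum b n e = (\<Sum>\<sigma> | \<sigma> permutes {..<2 * n}. ?q \<sigma>)"
    unfolding pairing_sum_def by (intro sum.cong) (auto simp: eq simp del: One_nat_def)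
  also have "\<dots> \<ge> ?q id"
  proof (rule member_le_sum)
    show "id \<in> {\<sigma>. \<sigma> permutes {..<2 * n}}" by (simp only: mem_Collect_eq permutes_id)
    show "0 \<le> ?q \<sigma>" if "\<sigma> \<in> {\<sigma>. \<sigma> permutes {..<2 * n}} - {id}" for \<sigma>
      using that pair_form_permutes_nonneg by blast
    show "finite {\<sigma>. \<sigma> permutes {..<2 * n}}" by (simp add: finite_permutations)
  qed
  also have "?q id = 1" by (simp add: pair_form_def)
  finally have "pairing_sum b n e > 0" by simp
  then show ?thesis using wedge_power_form2[of b n] by force
qed

text \<open>A step of symplectic Gram-Schmidt: split off the span of the family and choose a
  normalised pair in its \<open>b\<close>-complement. If \<open>b\<close> vanished on that
  complement, the complement would lie in the kernel of \<open>b\<close>, and kernel and family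
  together would span the space, against the dimension bound.\<close>

lemma symplectic_family_extend:
  fixes b :: "'e::euclidean_space \<Rightarrow> 'e \<Rightarrow> real"
  assumes bil: "bilinear b" and skew: "\<And>u v. b u v = - b v u"
    and e: "symplectic_family b e n" and dim: "dim {v. \<forall>w. b v w = 0} + 2 * n < DIM('e)"
  shows "\<exists>e'. symplectic_family b e' (Suc n)"
proof -
  have linl: "linear (\<lambda>u. b u z)" for z using bil by (simp add: bilinear_def)
  \<comment> \<open>\<open>s\<close> is the \<open>b\<close>-orthogonal projection onto the span of
    the family.\<close>
  define s where "s x = (\<Sum>i<n. b x (e (2 * i + 1)) *\<^sub>R e (2 * i) - b x (e (2 * i)) *\<^sub>R e (2 * i + 1))" for x
  have be: "b (e i) (e j) = pair_form i j" if "i < 2 * n" "j < 2 * n" for i j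
    using e that by (simp add: symplectic_family_def)
  have bs: "b (s x) z = (\<Sum>i<n. b x (e (2 * i + 1)) * b (e (2 * i)) z - b x (e (2 * i)) * b (e (2 * i + 1)) z)" for x z
    unfolding s_def by (simp add: linear_sum[OF linl] linear_diff[OF linl] linear_cmul[OF linl])
  have bse: "b (s x) (e j) = b x (e j)" if j: "j < 2 * n" for x j
  proof -
    have "b (s x) (e j) = (\<Sum>i<n. if i = j div 2 then b x (e j) else 0)"
      unfolding bs
    proof (rule sum.cong[OF refl])
      fix i assume i: "i \<in> {..<n}"
      have "j = 2 * (j div 2) \<or> j = 2 * (j div 2) + 1" by presburger
      then consider m where "j = 2 * m" | m where "j = 2 * m + 1" by blast
      then show "b x (e (2 * i + 1)) * b (e (2 * i)) (e j) - b x (e (2 * i)) * b (e (2 * i + 1)) (e j)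
          = (if i = j div 2 then b x (e j) else 0)"
        by cases (use i j in \<open>auto simp: be pair_form_def simp del: One_nat_def\<close>)
    qed
    also have "\<dots> = b x (e j)" using j by auto
    finally show ?thesis .
  qed
  have orth: "b (x - s x) (e j) = 0" if "j < 2 * n" for x j
    using bse[OF that] by (simp add: linear_diff[OF linl])
  have "\<exists>x y. b (x - s x) (y - s y) \<noteq> 0"
  proof (rule ccontr)
    assume "\<not> ?thesis"
    then have z: "b (x - s x) (y - s y) = 0" for x y by blast
    \<comment> \<open>Split \<open>y\<close> into \<open>y - s y\<close> and \<open>s y\<close>. The
      first part is covered by \<open>z\<close>, and the second is a combination of the
      \<open>e j\<close>, which are \<open>b\<close>-orthogonal to \<open>x - s x\<close>.\<close>
    have ker: "b (x - s x) y = 0" for x y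
    proof -
      have orth_left: "b (e j) (x - s x) = 0" if "j < 2 * n" for j
        using orth[OF that, of x] skew[of "e j" "x - s x"] by simp
      have "b (x - s x) (s y) = - b (s y) (x - s x)" by (rule skew)
      also have "b (s y) (x - s x) = 0"
        unfolding bs using orth_left by (intro sum.neutral) auto
      finally show ?thesis using z[of x y] by (simp add: bilinear_rsub[OF bil])
    qed
    let ?K = "{v. \<forall>w. b v w = 0}"
    obtain B where B: "B \<subseteq> ?K" "independent B" "?K \<subseteq> span B" "card B = dim ?K"
      using basis_exists by blast
    have "x \<in> span (B \<union> e ` {..<2 * n})" for x
    proof -
      have "x - s x \<in> span (B \<union> e ` {..<2 * n})"
        using ker B(3) span_mono[of B "B \<union> e ` {..<2 * n}"] by blast
      moreover have "s x \<in> span (B \<union> e ` {..<2 * n})"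
        unfolding s_def by (intro span_sum span_diff span_scale span_base) auto
      ultimately show ?thesis using span_add by fastforce
    qed
    then have "DIM('e) \<le> card (B \<union> e ` {..<2 * n})"
      using dim_le_card[of UNIV "B \<union> e ` {..<2 * n}"] independent_imp_finite[OF B(2)] by (auto simp: dim_UNIV)
    also have "\<dots> \<le> card B + card (e ` {..<2 * n})" by (rule card_Un_le)
    also have "\<dots> \<le> dim ?K + 2 * n" using card_image_le[of "{..<2 * n}" e] B(4) by simp
    finally show False using dim by simp
  qed
  then obtain x y where xy: "b (x - s x) (y - s y) \<noteq> 0" by blast
  define p where "p = x - s x"
  define q where "q = (1 / b (x - s x) (y - s y)) *\<^sub>R (y - s y)"
  have pq: "b p q = 1" "b q p = - 1"
    using xy skew[of q p] by (simp_all add: p_def q_def bilinear_rmul[OF bil])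
  have self: "b v v = 0" for v using skew[of v v] by simp
  have pe: "b p (e j) = 0" "b q (e j) = 0" "b (e j) p = 0" "b (e j) q = 0" if "j < 2 * n" for j
    using orth[OF that] skew[of "e j" p] skew[of "e j" q]
    by (simp_all add: p_def q_def bilinear_lmul[OF bil])
  define e' where "e' i = (if i = 2 * n then p else if i = 2 * n + 1 then q else e i)" for i
  have "b (e' i) (e' j) = pair_form i j" if ij: "i < 2 * Suc n" "j < 2 * Suc n" for i j
  proof -
    have split: "l < 2 * n \<or> l = 2 * n \<or> l = 2 * n + 1" if "l < 2 * Suc n" for l
      using that by presburger
    have ne: "l div 2 \<noteq> n" if "l < 2 * n" for l using that by simp
    consider "i < 2 * n" | "i = 2 * n" | "i = 2 * n + 1" using split[OF ij(1)] by blast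
    then show ?thesis
    proof cases
      case 1
      consider "j < 2 * n" | "j = 2 * n" | "j = 2 * n + 1" using split[OF ij(2)] by blast
      then show ?thesis using 1 ne[OF 1] by cases (simp_all add: e'_def pe be pair_form_def)
    next
      case 2
      consider "j < 2 * n" | "j = 2 * n" | "j = 2 * n + 1" using split[OF ij(2)] by blast
      then show ?thesis using 2 ne[of j] by cases (simp_all add: e'_def pe pq self pair_form_def)
    next
      case 3
      consider "j < 2 * n" | "j = 2 * n" | "j = 2 * n + 1" using split[OF ij(2)] by blast
      then show ?thesis using 3 ne[of j] by cases (simp_all add: e'_def pe pq self pair_form_def)
    qed
  qed
  then show ?thesis unfolding symplectic_family_def by blast
qed

text \<open>The vanishing power bounds the rank of \<open>b\<close> by \<open>2 * n\<close>. With a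
  larger rank, a symplectic family of \<open>n + 1\<close> pairs could be built step by step, and
  the power would be positive on it.\<close>

lemma dim_kernel_of_wedge_power_eq_0:
  fixes b :: "'e::euclidean_space \<Rightarrow> 'e \<Rightarrow> real"
  assumes bil: "bilinear b" and skew: "\<And>u v. b u v = - b v u"
    and zero: "wedge_power 2 (form2 b) (Suc n) = (\<lambda>v. 0)"
  shows "DIM('e) \<le> dim {v. \<forall>w. b v w = 0} + 2 * n"
proof (rule ccontr)
  assume less: "\<not> ?thesis"
  have "\<exists>e. symplectic_family b e m" if "m \<le> Suc n" for m
    using that
  proof (induction m)
    case 0
    show ?case by (simp add: symplectic_family_def)
  next
    case (Suc m)
    then obtain e where "symplectic_family b e m" by auto
    then show ?case
      by (rule symplectic_family_extend[OF bil skew]) (use less Suc.prems in simp)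
  qed
  then obtain e where "symplectic_family b e (Suc n)" by blast
  from wedge_power_symplectic_family[OF this] show False unfolding zero by simp
qed

section \<open>Metric contact pairs at a point\<close>

text \<open>The linear algebra of one tangent space: \<open>b\<^sub>1\<close> and
  \<open>b\<^sub>2\<close> stand for the exterior derivatives of the contact forms
  \<open>a\<^sub>1\<close> and \<open>a\<^sub>2\<close>. The last two assumptions express
  decomposability; its other half, that \<phi> maps into the kernels of the 1-forms, is
  \<open>a_\<phi>\<close>.\<close>

locale metric_contact_vector_space =
  fixes g b\<^sub>1 b\<^sub>2 :: "'e::euclidean_space \<Rightarrow> 'e \<Rightarrow> real"
    and a\<^sub>1 a\<^sub>2 :: "'e \<Rightarrow> real" and Z\<^sub>1 Z\<^sub>2 :: 'e and \<phi> :: "'e \<Rightarrow> 'e" and h k :: nat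
  assumes bil: "bilinear g" and sym: "g u v = g v u" and pos: "v \<noteq> 0 \<Longrightarrow> 0 < g v v"
    and bil1: "bilinear b\<^sub>1" and bil2: "bilinear b\<^sub>2"
    and skew1: "b\<^sub>1 u v = - b\<^sub>1 v u" and skew2: "b\<^sub>2 u v = - b\<^sub>2 v u"
    and a_Z: "a\<^sub>1 Z\<^sub>1 = 1" "a\<^sub>1 Z\<^sub>2 = 0" "a\<^sub>2 Z\<^sub>1 = 0" "a\<^sub>2 Z\<^sub>2 = 1"
    and b_Z: "b\<^sub>1 Z\<^sub>1 v = 0" "b\<^sub>1 Z\<^sub>2 v = 0" "b\<^sub>2 Z\<^sub>1 v = 0" "b\<^sub>2 Z\<^sub>2 v = 0"
    and lin_\<phi>: "linear \<phi>" and \<phi>_Z: "\<phi> Z\<^sub>1 = 0" "\<phi> Z\<^sub>2 = 0"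
    and \<phi>_\<phi>: "\<phi> (\<phi> v) = - v + a\<^sub>1 v *\<^sub>R Z\<^sub>1 + a\<^sub>2 v *\<^sub>R Z\<^sub>2"
    and g_\<phi>: "g u (\<phi> v) = b\<^sub>1 u v + b\<^sub>2 u v"
    and g_Z: "g v Z\<^sub>1 = a\<^sub>1 v" "g v Z\<^sub>2 = a\<^sub>2 v"
    and dims: "DIM('e) = 2 * h + 2 * k + 2"
    and power1: "wedge_power 2 (form2 b\<^sub>1) (h + 1) = (\<lambda>v. 0)"
    and power2: "wedge_power 2 (form2 b\<^sub>2) (k + 1) = (\<lambda>v. 0)"
    and decomposable1: "a\<^sub>1 v = 0 \<Longrightarrow> (\<And>w. b\<^sub>1 v w = 0) \<Longrightarrow> b\<^sub>1 (\<phi> v) w = 0"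
    and decomposable2: "a\<^sub>2 v = 0 \<Longrightarrow> (\<And>w. b\<^sub>2 v w = 0) \<Longrightarrow> b\<^sub>2 (\<phi> v) w = 0"
begin

lemmas bilinear_simps =
  bilinear_ladd[OF bil] bilinear_radd[OF bil] bilinear_lsub[OF bil] bilinear_rsub[OF bil]
  bilinear_lmul[OF bil] bilinear_rmul[OF bil] bilinear_lneg[OF bil] bilinear_rneg[OF bil]
  bilinear_lzero[OF bil] bilinear_rzero[OF bil]
  bilinear_ladd[OF bil1] bilinear_radd[OF bil1] bilinear_lsub[OF bil1] bilinear_rsub[OF bil1]
  bilinear_lmul[OF bil1] bilinear_rmul[OF bil1] bilinear_lneg[OF bil1] bilinear_rneg[OF bil1]
  bilinear_lzero[OF bil1] bilinear_rzero[OF bil1]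
  bilinear_ladd[OF bil2] bilinear_radd[OF bil2] bilinear_lsub[OF bil2] bilinear_rsub[OF bil2]
  bilinear_lmul[OF bil2] bilinear_rmul[OF bil2] bilinear_lneg[OF bil2] bilinear_rneg[OF bil2]
  bilinear_lzero[OF bil2] bilinear_rzero[OF bil2]

lemma lin_a: "linear a\<^sub>1" "linear a\<^sub>2"
  by (rule linearI; simp only: g_Z[symmetric]; simp add: bilinear_simps)+

lemma b_Z_right: "b\<^sub>1 v Z\<^sub>1 = 0" "b\<^sub>1 v Z\<^sub>2 = 0" "b\<^sub>2 v Z\<^sub>1 = 0" "b\<^sub>2 v Z\<^sub>2 = 0"
  using b_Z skew1[of v Z\<^sub>1] skew1[of v Z\<^sub>2] skew2[of v Z\<^sub>1] skew2[of v Z\<^sub>2] by simp_all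

lemma b_self: "b\<^sub>1 v v = 0" "b\<^sub>2 v v = 0"
  using skew1[of v v] skew2[of v v] by simp_all

lemma g_\<phi>_left: "g (\<phi> u) v = - g u (\<phi> v)"
  using sym[of "\<phi> u" v] g_\<phi>[of v u] g_\<phi>[of u v] skew1[of v u] skew2[of v u] by simp

lemma a_\<phi>: "a\<^sub>1 (\<phi> v) = 0" "a\<^sub>2 (\<phi> v) = 0"
  unfolding g_Z[symmetric] g_\<phi>_left \<phi>_Z by (simp_all add: bilinear_simps)

text \<open>\<open>TM = T\<F>\<^sub>1 \<oplus> T\<F>\<^sub>2\<close>: the vanishing powers bound the ranks of \<open>b\<^sub>1\<close>, \<open>b\<^sub>2\<close>, and dimensions add up.\<close>

lemma char_spaces_span:
  obtains v\<^sub>1 v\<^sub>2 where "v = v\<^sub>1 + v\<^sub>2" "a\<^sub>1 v\<^sub>1 = 0" "\<And>w. b\<^sub>1 v\<^sub>1 w = 0" "a\<^sub>2 v\<^sub>2 = 0" "\<And>w. b\<^sub>2 v\<^sub>2 w = 0"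
proof -
  let ?K\<^sub>1 = "{v. \<forall>w. b\<^sub>1 v w = 0}" and ?K\<^sub>2 = "{v. \<forall>w. b\<^sub>2 v w = 0}"
  let ?F\<^sub>1 = "{v. a\<^sub>1 v = 0 \<and> (\<forall>w. b\<^sub>1 v w = 0)}" and ?F\<^sub>2 = "{v. a\<^sub>2 v = 0 \<and> (\<forall>w. b\<^sub>2 v w = 0)}"
  note lin = linear_add[OF lin_a(1)] linear_add[OF lin_a(2)] linear_cmul[OF lin_a(1)]
    linear_cmul[OF lin_a(2)] linear_0[OF lin_a(1)] linear_0[OF lin_a(2)] linear_diff[OF lin_a(1)]
    linear_diff[OF lin_a(2)]
  have sub: "subspace ?F\<^sub>1" "subspace ?F\<^sub>2"
    by (auto simp: subspace_def lin bilinear_simps)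
  have 1: "DIM('e) \<le> dim ?F\<^sub>1 + 1 + 2 * h"
  proof -
    \<comment> \<open>Subtracting a multiple of \<open>Z\<^sub>1\<close> moves a kernel vector into
      \<open>?F\<^sub>1\<close>, so passing from \<open>?K\<^sub>1\<close> to
      \<open>?F\<^sub>1\<close> costs at most one dimension.\<close>
    have "?K\<^sub>1 \<subseteq> span (insert Z\<^sub>1 ?F\<^sub>1)"
    proof
      fix v assume v: "v \<in> ?K\<^sub>1"
      then have "v - a\<^sub>1 v *\<^sub>R Z\<^sub>1 \<in> ?F\<^sub>1" by (simp add: lin a_Z b_Z bilinear_simps)
      then have "v - a\<^sub>1 v *\<^sub>R Z\<^sub>1 \<in> span ?F\<^sub>1" by (rule span_base)
      then show "v \<in> span (insert Z\<^sub>1 ?F\<^sub>1)" unfolding span_breakdown_eq by (rule exI)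
    qed
    from dim_subset[OF this] have "dim ?K\<^sub>1 \<le> dim (insert Z\<^sub>1 ?F\<^sub>1)" unfolding dim_span .
    also have "\<dots> \<le> dim ?F\<^sub>1 + 1" by (simp add: dim_insert)
    finally show ?thesis
      using dim_kernel_of_wedge_power_eq_0[OF bil1 skew1, of h] power1 by simp
  qed
  have 2: "DIM('e) \<le> dim ?F\<^sub>2 + 1 + 2 * k"
  proof -
    have "?K\<^sub>2 \<subseteq> span (insert Z\<^sub>2 ?F\<^sub>2)"
    proof
      fix v assume v: "v \<in> ?K\<^sub>2"
      then have "v - a\<^sub>2 v *\<^sub>R Z\<^sub>2 \<in> ?F\<^sub>2" by (simp add: lin a_Z b_Z bilinear_simps)
      then have "v - a\<^sub>2 v *\<^sub>R Z\<^sub>2 \<in> span ?F\<^sub>2" by (rule span_base)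
      then show "v \<in> span (insert Z\<^sub>2 ?F\<^sub>2)" unfolding span_breakdown_eq by (rule exI)
    qed
    from dim_subset[OF this] have "dim ?K\<^sub>2 \<le> dim (insert Z\<^sub>2 ?F\<^sub>2)" unfolding dim_span .
    also have "\<dots> \<le> dim ?F\<^sub>2 + 1" by (simp add: dim_insert)
    finally show ?thesis
      using dim_kernel_of_wedge_power_eq_0[OF bil2 skew2, of k] power2 by simp
  qed
  have "v = 0" if "v \<in> ?F\<^sub>1 \<inter> ?F\<^sub>2" for v
  proof -
    \<comment> \<open>Both 2-forms vanish on \<open>v\<close>, while
      \<open>\<phi> (\<phi> v) = - v\<close> because both 1-forms vanish on it.\<close>
    have "g v (\<phi> (\<phi> v)) = 0" using that g_\<phi>[of v "\<phi> v"] by simp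
    then have "g v v = 0" using that by (simp add: \<phi>_\<phi> bilinear_simps)
    then show ?thesis using pos[of v] by force
  qed
  then have "dim (?F\<^sub>1 \<inter> ?F\<^sub>2) = 0" unfolding dim_eq_0 by blast
  \<comment> \<open>The bounds read \<open>2 * k + 1 \<le> dim ?F\<^sub>1\<close> and
    \<open>2 * h + 1 \<le> dim ?F\<^sub>2\<close>, and these add up to the full dimension.\<close>
  then have "dim {x + y |x y. x \<in> ?F\<^sub>1 \<and> y \<in> ?F\<^sub>2} = dim (UNIV :: 'e set)"
    using dim_sums_Int[OF sub] 1 2 dims dim_subset_UNIV[of "{x + y |x y. x \<in> ?F\<^sub>1 \<and> y \<in> ?F\<^sub>2}"]
    unfolding dim_UNIV by linarith
  then have "span {x + y |x y. x \<in> ?F\<^sub>1 \<and> y \<in> ?F\<^sub>2} = UNIV"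
    using dim_eq_full[of "{x + y |x y. x \<in> ?F\<^sub>1 \<and> y \<in> ?F\<^sub>2}"] unfolding dim_UNIV by simp
  then have "v \<in> {x + y |x y. x \<in> ?F\<^sub>1 \<and> y \<in> ?F\<^sub>2}"
    using span_eq_iff[THEN iffD2, OF subspace_sums[OF sub]] by blast
  then show thesis using that by blast
qed

text \<open>Split \<open>v\<close> along the characteristic spaces. Decomposability keeps
  \<open>\<phi> v\<^sub>1\<close> in the kernel of \<open>b\<^sub>1\<close>, so only
  \<open>v\<^sub>2\<close> contributes to the first value. Since \<open>b\<^sub>2\<close> vanishes
  on \<open>v\<^sub>2\<close>, that value is \<open>g v\<^sub>2 (\<phi> (\<phi> v\<^sub>2))\<close>,
  minus the squared length of \<open>\<phi> v\<^sub>2\<close>. The second value is treated in the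
  same way.\<close>

lemma b_\<phi>_nonpos: "b\<^sub>1 v (\<phi> v) \<le> 0" "b\<^sub>2 v (\<phi> v) \<le> 0"
proof -
  obtain v\<^sub>1 v\<^sub>2 where v: "v = v\<^sub>1 + v\<^sub>2" "a\<^sub>1 v\<^sub>1 = 0" "\<And>w. b\<^sub>1 v\<^sub>1 w = 0" "a\<^sub>2 v\<^sub>2 = 0" "\<And>w. b\<^sub>2 v\<^sub>2 w = 0"
    using char_spaces_span by blast
  have \<phi>v: "b\<^sub>1 w (\<phi> v\<^sub>1) = 0" "b\<^sub>2 w (\<phi> v\<^sub>2) = 0" for w
    using decomposable1[OF v(2,3)] decomposable2[OF v(4,5)] skew1[of w "\<phi> v\<^sub>1"] skew2[of w "\<phi> v\<^sub>2"] by simp_all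
  have neg: "g w (\<phi> (\<phi> w)) \<le> 0" for w
  proof (cases "\<phi> w = 0")
    case True
    then show ?thesis by (simp add: linear_0[OF lin_\<phi>] bilinear_simps)
  next
    case False
    then show ?thesis using g_\<phi>_left[of w "\<phi> w"] pos[of "\<phi> w"] by simp
  qed
  have "b\<^sub>1 v (\<phi> v) = g v\<^sub>2 (\<phi> (\<phi> v\<^sub>2))" "b\<^sub>2 v (\<phi> v) = g v\<^sub>1 (\<phi> (\<phi> v\<^sub>1))"
    unfolding g_\<phi> v(1) linear_add[OF lin_\<phi>] by (simp_all add: bilinear_simps v(3,5) \<phi>v)
  then show "b\<^sub>1 v (\<phi> v) \<le> 0" "b\<^sub>2 v (\<phi> v) \<le> 0" using neg by simp_all
qed

definition J :: "'e \<Rightarrow> 'e"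
  where "J v = \<phi> v - a\<^sub>2 v *\<^sub>R Z\<^sub>1 + a\<^sub>1 v *\<^sub>R Z\<^sub>2"

lemma lin_J: "linear J"
  by (rule linearI) (simp_all add: J_def linear_add[OF lin_\<phi>] linear_cmul[OF lin_\<phi>]
      linear_add[OF lin_a(1)] linear_add[OF lin_a(2)] linear_cmul[OF lin_a(1)] linear_cmul[OF lin_a(2)]
      algebra_simps)

lemma a_J: "a\<^sub>1 (J v) = - a\<^sub>2 v" "a\<^sub>2 (J v) = a\<^sub>1 v"
  by (simp_all add: J_def linear_add[OF lin_a(1)] linear_add[OF lin_a(2)] linear_diff[OF lin_a(1)]
      linear_diff[OF lin_a(2)] linear_cmul[OF lin_a(1)] linear_cmul[OF lin_a(2)] a_\<phi> a_Z)

lemma b_J: "b\<^sub>1 u (J v) = b\<^sub>1 u (\<phi> v)" "b\<^sub>2 u (J v) = b\<^sub>2 u (\<phi> v)"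
  by (simp_all add: J_def bilinear_simps b_Z_right)

lemma J_J: "J (J v) = - v"
proof -
  have "\<phi> (J v) = \<phi> (\<phi> v)"
    by (simp add: J_def linear_add[OF lin_\<phi>] linear_diff[OF lin_\<phi>] linear_cmul[OF lin_\<phi>] \<phi>_Z)
  then show ?thesis by (subst J_def) (simp add: a_J \<phi>_\<phi>)
qed

lemma J_Z: "J Z\<^sub>1 = Z\<^sub>2" "J Z\<^sub>2 = - Z\<^sub>1"
  by (simp_all add: J_def \<phi>_Z a_Z)

lemma g_J: "g u (J v) = b\<^sub>1 u v + b\<^sub>2 u v - a\<^sub>1 u * a\<^sub>2 v + a\<^sub>2 u * a\<^sub>1 v"
  by (simp add: J_def bilinear_simps g_\<phi> g_Z)

lemma g_J_left: "g (J u) v = - g u (J v)"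
  using sym[of "J u" v] g_J[of u v] g_J[of v u] skew1[of u v] skew2[of u v] by simp

text \<open>The values at \<open>(X, Y, V)\<close> of \<open>d\<alpha>\<^sub>1 \<and> \<alpha>\<^sub>2 - d\<alpha>\<^sub>2 \<and> \<alpha>\<^sub>1\<close>, up to normalisation.\<close>

definition \<Theta> :: "'e \<Rightarrow> 'e \<Rightarrow> 'e \<Rightarrow> real"
  where "\<Theta> X Y V = (b\<^sub>1 X Y * a\<^sub>2 V + b\<^sub>1 Y V * a\<^sub>2 X + b\<^sub>1 V X * a\<^sub>2 Y)
    - (b\<^sub>2 X Y * a\<^sub>1 V + b\<^sub>2 Y V * a\<^sub>1 X + b\<^sub>2 V X * a\<^sub>1 Y)"

section \<open>Trace of \<Theta> over a \<open>J\<close>-invariant subspace\<close>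

context
  fixes T :: "'e set" and E :: "'e set"
  assumes T: "span E = T" and JT: "J ` T \<subseteq> T" and fin: "finite E"
    and orthonormal: "\<And>e e'. e \<in> E \<Longrightarrow> e' \<in> E \<Longrightarrow> g e e' = (if e = e' then 1 else 0)"
begin

definition P :: "'e \<Rightarrow> 'e"
  where "P v = (\<Sum>e\<in>E. g v e *\<^sub>R e)"

lemma P_in: "P v \<in> T"
  unfolding P_def T[symmetric] by (intro span_sum span_scale span_base)

lemma P_orth: "t \<in> T \<Longrightarrow> g (v - P v) t = 0"
proof -
  have lin: "linear (\<lambda>u. g u z)" "linear (g z)" for z using bil by (simp_all add: bilinear_def)
  have "g (v - P v) e = 0" if e: "e \<in> E" for e
  proof -
    have "g (P v) e = (\<Sum>e'\<in>E. g v e' * g e' e)"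
      by (simp add: P_def linear_sum[OF lin(1)] linear_cmul[OF lin(1)])
    also have "\<dots> = (\<Sum>e'\<in>E. if e' = e then g v e else 0)"
      by (rule sum.cong) (auto simp: orthonormal e)
    finally show ?thesis using e fin by (simp add: bilinear_simps)
  qed
  then have "g (v - P v) t = 0" if "t \<in> span E" for t
    using linear_eq_on_span[OF lin(2)[of "v - P v"] linear_zero _ that] by simp
  then show "t \<in> T \<Longrightarrow> g (v - P v) t = 0" using T by simp
qed

lemma P_unique: "w \<in> T \<Longrightarrow> (\<And>t. t \<in> T \<Longrightarrow> g (v - w) t = 0) \<Longrightarrow> P v = w"
proof -
  assume w: "w \<in> T" and orth: "\<And>t. t \<in> T \<Longrightarrow> g (v - w) t = 0"
  have "P v - w \<in> T" using P_in[of v] w T subspace_diff[OF subspace_span, of _ E] by blast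
  then have "g (v - w) (P v - w) - g (v - P v) (P v - w) = 0" using P_orth orth by simp
  then have "g (P v - w) (P v - w) = 0" by (simp add: bilinear_simps)
  then show "P v = w" using pos[of "P v - w"] by force
qed

text \<open>\<open>J\<close> preserves \<open>T\<close> and is skew for \<open>g\<close>, so it also
  preserves the orthogonal complement of \<open>T\<close>; hence it commutes with the orthogonal
  projection \<open>P\<close>.\<close>

lemma J_P: "J (P v) = P (J v)"
proof (rule P_unique[symmetric])
  show "J (P v) \<in> T" using JT P_in by blast
  fix t assume "t \<in> T"
  then show "g (J v - J (P v)) t = 0"
    using P_orth[of "J t" v] JT g_J_left[of "v - P v" t] by (auto simp: linear_diff[OF lin_J])
qed

lemma P_Z: "P Z\<^sub>1 = (\<Sum>e\<in>E. a\<^sub>1 e *\<^sub>R e)" "P Z\<^sub>2 = (\<Sum>e\<in>E. a\<^sub>2 e *\<^sub>R e)"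
  unfolding P_def g_Z[symmetric] by (simp_all add: sym)

text \<open>By \<open>P_Z\<close>, weighting the frame with \<open>a\<^sub>1\<close> or
  \<open>a\<^sub>2\<close> contracts it to the tangential part of a Reeb vector, and
  \<open>J_P\<close> does the same for the vectors \<open>J e\<close>. The only sums left are the
  traces of \<open>b\<^sub>1\<close> and \<open>b\<^sub>2\<close> against \<phi>.\<close>

lemma sum_\<Theta>:
  "(\<Sum>e\<in>E. \<Theta> e (J e) V) = a\<^sub>2 V * (\<Sum>e\<in>E. b\<^sub>1 e (\<phi> e)) - a\<^sub>1 V * (\<Sum>e\<in>E. b\<^sub>2 e (\<phi> e))
    + 2 * b\<^sub>1 V (P Z\<^sub>1) + 2 * b\<^sub>2 V (P Z\<^sub>2)"
proof -
  have linl: "linear (\<lambda>u. b\<^sub>1 u V)" "linear (\<lambda>u. b\<^sub>2 u V)" and linr: "linear (b\<^sub>1 V)" "linear (b\<^sub>2 V)"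
    using bil1 bil2 by (simp_all add: bilinear_def)
  have P_neg: "P (- v) = - P v" for v by (simp add: P_def bilinear_simps sum_negf)
  have JP: "(\<Sum>e\<in>E. a\<^sub>2 e *\<^sub>R J e) = - P Z\<^sub>1" "(\<Sum>e\<in>E. a\<^sub>1 e *\<^sub>R J e) = P Z\<^sub>2"
    using J_P[of Z\<^sub>1] J_P[of Z\<^sub>2] P_neg
    by (simp_all add: P_Z J_Z linear_sum[OF lin_J] linear_cmul[OF lin_J])
  have "(\<Sum>e\<in>E. b\<^sub>1 V e * a\<^sub>1 e) = b\<^sub>1 V (P Z\<^sub>1)" "(\<Sum>e\<in>E. b\<^sub>2 V e * a\<^sub>2 e) = b\<^sub>2 V (P Z\<^sub>2)"
    by (simp_all add: P_Z linear_sum[OF linr(1)] linear_cmul[OF linr(1)]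
      linear_sum[OF linr(2)] linear_cmul[OF linr(2)] mult.commute)
  moreover have "(\<Sum>e\<in>E. b\<^sub>1 (J e) V * a\<^sub>2 e) = b\<^sub>1 V (P Z\<^sub>1)"
  proof -
    have "(\<Sum>e\<in>E. b\<^sub>1 (J e) V * a\<^sub>2 e) = b\<^sub>1 (\<Sum>e\<in>E. a\<^sub>2 e *\<^sub>R J e) V"
      by (simp add: linear_sum[OF linl(1)] linear_cmul[OF linl(1)] mult.commute)
    then show ?thesis using skew1[of "P Z\<^sub>1" V] by (simp add: JP bilinear_simps)
  qed
  moreover have "(\<Sum>e\<in>E. b\<^sub>2 (J e) V * a\<^sub>1 e) = - b\<^sub>2 V (P Z\<^sub>2)"
  proof -
    have "(\<Sum>e\<in>E. b\<^sub>2 (J e) V * a\<^sub>1 e) = b\<^sub>2 (\<Sum>e\<in>E. a\<^sub>1 e *\<^sub>R J e) V"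
      by (simp add: linear_sum[OF linl(2)] linear_cmul[OF linl(2)] mult.commute)
    then show ?thesis using skew2[of "P Z\<^sub>2" V] by (simp add: JP)
  qed
  moreover have "(\<Sum>e\<in>E. \<Theta> e (J e) V) = a\<^sub>2 V * (\<Sum>e\<in>E. b\<^sub>1 e (\<phi> e)) - a\<^sub>1 V * (\<Sum>e\<in>E. b\<^sub>2 e (\<phi> e))
    + (\<Sum>e\<in>E. b\<^sub>1 (J e) V * a\<^sub>2 e) + (\<Sum>e\<in>E. b\<^sub>1 V e * a\<^sub>1 e)
    - (\<Sum>e\<in>E. b\<^sub>2 (J e) V * a\<^sub>1 e) + (\<Sum>e\<in>E. b\<^sub>2 V e * a\<^sub>2 e)"
    unfolding sum_distrib_left sum.distrib[symmetric] sum_subtractf[symmetric]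
    by (rule sum.cong) (simp_all add: \<Theta>_def a_J b_J algebra_simps)
  ultimately show ?thesis by simp
qed

lemma reeb_tangent_imp_sum_\<Theta>_eq_0:
  assumes Z: "Z\<^sub>1 \<in> T" "Z\<^sub>2 \<in> T" and V: "\<And>t. t \<in> T \<Longrightarrow> g V t = 0"
  shows "(\<Sum>e\<in>E. \<Theta> e (J e) V) = 0"
proof -
  have "P Z\<^sub>1 = Z\<^sub>1" "P Z\<^sub>2 = Z\<^sub>2" using Z by (auto intro!: P_unique simp: bilinear_simps)
  then show ?thesis
    using V[OF Z(1)] V[OF Z(2)] by (simp add: sum_\<Theta> g_Z b_Z_right)
qed

text \<open>The hypothesis is tested on the normal parts of the two Reeb vectors. Each test yields
  two nonpositive terms with sum 0, so both terms vanish.\<close>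

lemma sum_\<Theta>_eq_0_imp_reeb_tangent:
  assumes zero: "\<And>V. (\<And>t. t \<in> T \<Longrightarrow> g V t = 0) \<Longrightarrow> (\<Sum>e\<in>E. \<Theta> e (J e) V) = 0"
    and nontrivial: "T \<noteq> {0}"
  shows "Z\<^sub>1 \<in> T \<and> Z\<^sub>2 \<in> T"
proof -
  have subT: "subspace T" using T subspace_span by blast
  define n\<^sub>1 where "n\<^sub>1 = Z\<^sub>1 - P Z\<^sub>1"
  define n\<^sub>2 where "n\<^sub>2 = Z\<^sub>2 - P Z\<^sub>2"
  define A\<^sub>1 where "A\<^sub>1 = (\<Sum>e\<in>E. b\<^sub>1 e (\<phi> e))"
  define A\<^sub>2 where "A\<^sub>2 = (\<Sum>e\<in>E. b\<^sub>2 e (\<phi> e))"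
  have PZ: "P Z\<^sub>1 = Z\<^sub>1 - n\<^sub>1" "P Z\<^sub>2 = Z\<^sub>2 - n\<^sub>2" by (simp_all add: n\<^sub>1_def n\<^sub>2_def)
  \<comment> \<open>Consequently the two normal parts are orthogonal, have equal length and vanish
    together.\<close>
  have n2: "n\<^sub>2 = J n\<^sub>1" by (simp add: n\<^sub>1_def n\<^sub>2_def linear_diff[OF lin_J] J_P J_Z)
  have orth: "g n\<^sub>1 t = 0" "g n\<^sub>2 t = 0" if "t \<in> T" for t
    using P_orth[OF that] by (simp_all add: n\<^sub>1_def n\<^sub>2_def)
  have g12: "g n\<^sub>1 n\<^sub>2 = 0" using g_J_left[of n\<^sub>1 n\<^sub>1] sym[of "J n\<^sub>1" n\<^sub>1] n2 by simp
  have g22: "g n\<^sub>2 n\<^sub>2 = g n\<^sub>1 n\<^sub>1" unfolding n2 g_J_left J_J by (simp add: bilinear_simps)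
  have a: "a\<^sub>1 n\<^sub>1 = g n\<^sub>1 n\<^sub>1" "a\<^sub>2 n\<^sub>1 = 0" "a\<^sub>1 n\<^sub>2 = 0" "a\<^sub>2 n\<^sub>2 = g n\<^sub>1 n\<^sub>1"
    using orth[OF P_in[of Z\<^sub>1]] orth[OF P_in[of Z\<^sub>2]] g12 g22 sym[of n\<^sub>2 n\<^sub>1]
    by (simp_all add: PZ bilinear_simps g_Z)
  \<comment> \<open>The Reeb vectors lie in the kernels of both 2-forms, so each tangential part can
    be replaced by the negative of the normal part.\<close>
  have b: "b\<^sub>1 n\<^sub>1 (P Z\<^sub>1) = 0" "b\<^sub>2 n\<^sub>1 (P Z\<^sub>2) = - b\<^sub>2 n\<^sub>1 (\<phi> n\<^sub>1)"
      "b\<^sub>1 n\<^sub>2 (P Z\<^sub>1) = b\<^sub>1 n\<^sub>1 (\<phi> n\<^sub>1)" "b\<^sub>2 n\<^sub>2 (P Z\<^sub>2) = 0"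
    using skew1[of n\<^sub>2 n\<^sub>1] n2 b_J[of n\<^sub>1 n\<^sub>1] by (simp_all add: PZ bilinear_simps b_Z_right b_self)
  have A: "A\<^sub>1 \<le> 0" "A\<^sub>2 \<le> 0" unfolding A\<^sub>1_def A\<^sub>2_def by (intro sum_nonpos b_\<phi>_nonpos)+
  have gn: "0 \<le> g n\<^sub>1 n\<^sub>1" using pos[of n\<^sub>1] by (cases "n\<^sub>1 = 0") (auto simp: bilinear_simps)
  have 1: "g n\<^sub>1 n\<^sub>1 * A\<^sub>2 + 2 * b\<^sub>2 n\<^sub>1 (\<phi> n\<^sub>1) = 0"
    using zero[of n\<^sub>1] orth by (simp add: sum_\<Theta> a b A\<^sub>1_def[symmetric] A\<^sub>2_def[symmetric])
  have 2: "g n\<^sub>1 n\<^sub>1 * A\<^sub>1 + 2 * b\<^sub>1 n\<^sub>1 (\<phi> n\<^sub>1) = 0"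
    using zero[of n\<^sub>2] orth by (simp add: sum_\<Theta> a b A\<^sub>1_def[symmetric] A\<^sub>2_def[symmetric])
  have prod0: "g n\<^sub>1 n\<^sub>1 * A\<^sub>1 = 0" "g n\<^sub>1 n\<^sub>1 * A\<^sub>2 = 0"
    using 1 2 mult_nonneg_nonpos[OF gn A(1)] mult_nonneg_nonpos[OF gn A(2)] b_\<phi>_nonpos[of n\<^sub>1] by linarith+
  have "n\<^sub>1 = 0"
  proof (rule ccontr)
    assume n: "n\<^sub>1 \<noteq> 0"
    then have A0: "A\<^sub>1 = 0" "A\<^sub>2 = 0" using prod0 pos[OF n] by auto
    obtain e where e: "e \<in> E" using nontrivial T by fastforce
    then have "e \<noteq> 0" using orthonormal[OF e e] by (auto simp: bilinear_simps)
    \<comment> \<open>The traces are sums of nonpositive terms, so every term is 0. The two terms at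
      \<open>e\<close> add up to minus the squared length of \<open>\<phi> e\<close>.\<close>
    have "b\<^sub>1 e (\<phi> e) = 0" "b\<^sub>2 e (\<phi> e) = 0"
      using A0 e sum_nonneg_eq_0_iff[OF fin, of "\<lambda>e. - b\<^sub>1 e (\<phi> e)"]
        sum_nonneg_eq_0_iff[OF fin, of "\<lambda>e. - b\<^sub>2 e (\<phi> e)"] b_\<phi>_nonpos
      unfolding A\<^sub>1_def A\<^sub>2_def by (simp_all add: sum_negf)
    then have "g (\<phi> e) (\<phi> e) = 0" using g_\<phi>_left[of e "\<phi> e"] g_\<phi>[of e "\<phi> e"] by simp
    then have "\<phi> e = 0" using pos[of "\<phi> e"] by force
    then have eZ: "e = a\<^sub>1 e *\<^sub>R Z\<^sub>1 + a\<^sub>2 e *\<^sub>R Z\<^sub>2"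
      using \<phi>_\<phi>[of e] linear_0[OF lin_\<phi>] by (simp add: eq_neg_iff_add_eq_0 algebra_simps)
    have Je: "J e = - a\<^sub>2 e *\<^sub>R Z\<^sub>1 + a\<^sub>1 e *\<^sub>R Z\<^sub>2"
      using \<open>\<phi> e = 0\<close> by (simp add: J_def)
    have eT: "e \<in> T" "J e \<in> T" using e T JT span_base by blast+
    \<comment> \<open>Now \<open>e\<close> and \<open>J e\<close> lie in the Reeb plane, and
      rotating \<open>e\<close> back inside that plane gives a nonzero multiple of
      \<open>Z\<^sub>1\<close>.\<close>
    have "a\<^sub>1 e *\<^sub>R e - a\<^sub>2 e *\<^sub>R J e = ((a\<^sub>1 e)\<^sup>2 + (a\<^sub>2 e)\<^sup>2) *\<^sub>R Z\<^sub>1"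
      by (subst (2) eZ) (simp add: Je power2_eq_square algebra_simps)
    then have "((a\<^sub>1 e)\<^sup>2 + (a\<^sub>2 e)\<^sup>2) *\<^sub>R Z\<^sub>1 \<in> T"
      using subspace_diff[OF subT subspace_scale[OF subT eT(1)] subspace_scale[OF subT eT(2)]] by metis
    moreover have "(a\<^sub>1 e)\<^sup>2 + (a\<^sub>2 e)\<^sup>2 \<noteq> 0"
      using eZ \<open>e \<noteq> 0\<close> by (auto simp: sum_power2_eq_zero_iff)
    ultimately have "Z\<^sub>1 \<in> T"
      using subspace_scale[OF subT, of "((a\<^sub>1 e)\<^sup>2 + (a\<^sub>2 e)\<^sup>2) *\<^sub>R Z\<^sub>1" "inverse ((a\<^sub>1 e)\<^sup>2 + (a\<^sub>2 e)\<^sup>2)"]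
      by simp
    then have "P Z\<^sub>1 = Z\<^sub>1" by (auto intro!: P_unique simp: bilinear_simps)
    then show False using n by (simp add: n\<^sub>1_def)
  qed
  then have "Z\<^sub>1 \<in> T" using P_in[of Z\<^sub>1] by (simp add: n\<^sub>1_def)
  then show ?thesis using JT J_Z by (metis image_subset_iff)
qed

end

end

section \<open>Differential calculus\<close>

lemma smooth_on_differentiable: "smooth_on S f \<Longrightarrow> x \<in> S \<Longrightarrow> f differentiable (at x)"
  unfolding smooth_on_def by (metis ck_on.simps(2))

lemma smooth_on_ddir: "smooth_on S f \<Longrightarrow> smooth_on S (\<lambda>x. ddir f x v)"
  unfolding smooth_on_def by (metis ck_on.simps(2))

lemma smooth_on_continuous: "smooth_on S f \<Longrightarrow> continuous_on S f"
  unfolding smooth_on_def by (metis ck_on.simps(1))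

lemma ddir_eqI: "(f has_derivative f') (at x) \<Longrightarrow> ddir f x v = f' v"
  using frechet_derivative_at by metis

lemma ddir_works: "f differentiable (at x) \<Longrightarrow> (f has_derivative ddir f x) (at x)"
  using frechet_derivative_works by blast

lemma linear_ddir: "f differentiable (at x) \<Longrightarrow> linear (ddir f x)"
  using ddir_works has_derivative_linear by blast

text \<open>\<open>frechet_derivative\<close> is a choice from the set of all derivatives at the
  point. Both functions have the same set, which settles points of nondifferentiability as
  well.\<close>

lemma ddir_cong:
  assumes "open S" "x \<in> S" "\<And>z. z \<in> S \<Longrightarrow> f z = g z"
  shows "ddir f x v = ddir g x v"
proof -
  have "(f has_derivative D) (at x) \<longleftrightarrow> (g has_derivative D) (at x)" for D
    using has_derivative_transform_within_open[OF _ assms(1,2), of f D UNIV g]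
      has_derivative_transform_within_open[OF _ assms(1,2), of g D UNIV f] assms(3) by auto
  then show ?thesis by (simp add: frechet_derivative_def)
qed

section \<open>Symmetry of second derivatives\<close>

lemma has_real_derivative_along_line:
  fixes F :: "'a::real_normed_vector \<Rightarrow> real"
  assumes "F differentiable (at (p + s *\<^sub>R u))"
  shows "((\<lambda>s. F (p + s *\<^sub>R u)) has_real_derivative ddir F (p + s *\<^sub>R u) u) (at s)"
proof -
  have "((\<lambda>s. p + s *\<^sub>R u) has_derivative (\<lambda>h. h *\<^sub>R u)) (at s)"
    by (auto intro!: derivative_eq_intros)
  from has_derivative_compose[OF this ddir_works[OF assms]]
  show ?thesis
    by (simp add: has_field_derivative_def linear_cmul[OF linear_ddir[OF assms]] mult_commute_abs)
qed

text \<open>The mean value theorem is used twice: along \<open>u\<close> for the increment \<psi> in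
  direction \<open>v\<close>, then along \<open>v\<close> for the resulting directional
  derivative.\<close>

lemma second_difference_mvt:
  fixes F :: "'a::real_normed_vector \<Rightarrow> real"
  assumes t: "0 < t"
    and S: "\<And>a b. 0 \<le> a \<Longrightarrow> a \<le> t \<Longrightarrow> 0 \<le> b \<Longrightarrow> b \<le> t \<Longrightarrow> x + a *\<^sub>R u + b *\<^sub>R v \<in> S"
    and F: "\<And>z. z \<in> S \<Longrightarrow> F differentiable (at z)"
    and G: "\<And>z. z \<in> S \<Longrightarrow> (\<lambda>z. ddir F z u) differentiable (at z)"
  shows "\<exists>a b. 0 < a \<and> a < t \<and> 0 < b \<and> b < t \<and>
    F (x + t *\<^sub>R u + t *\<^sub>R v) - F (x + t *\<^sub>R u) - F (x + t *\<^sub>R v) + F x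
      = t * t * ddir (\<lambda>z. ddir F z u) (x + a *\<^sub>R u + b *\<^sub>R v) v"
proof -
  define \<psi> where "\<psi> s = F ((x + t *\<^sub>R v) + s *\<^sub>R u) - F (x + s *\<^sub>R u)" for s
  have swap: "x + t *\<^sub>R v + s *\<^sub>R u = x + s *\<^sub>R u + t *\<^sub>R v" for s by simp
  have "(\<psi> has_real_derivative ddir F ((x + t *\<^sub>R v) + s *\<^sub>R u) u - ddir F (x + s *\<^sub>R u) u) (at s)"
    if "0 \<le> s" "s \<le> t" for s
    unfolding \<psi>_def
    by (intro DERIV_diff has_real_derivative_along_line F)
      (use S[of s t] S[of s 0] t that in \<open>simp_all add: swap\<close>)
  from MVT2[OF t this] obtain a where a: "0 < a" "a < t"
    "\<psi> t - \<psi> 0 = t * (ddir F ((x + t *\<^sub>R v) + a *\<^sub>R u) u - ddir F (x + a *\<^sub>R u) u)"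
    by auto
  have "((\<lambda>s. ddir F (x + a *\<^sub>R u + s *\<^sub>R v) u) has_real_derivative
      ddir (\<lambda>z. ddir F z u) (x + a *\<^sub>R u + s *\<^sub>R v) v) (at s)" if "0 \<le> s" "s \<le> t" for s
    by (rule has_real_derivative_along_line[OF G]) (use S[of a s] a that in simp)
  from MVT2[OF t this] obtain b where "0 < b" "b < t"
    "ddir F (x + a *\<^sub>R u + t *\<^sub>R v) u - ddir F (x + a *\<^sub>R u) u
      = t * ddir (\<lambda>z. ddir F z u) (x + a *\<^sub>R u + b *\<^sub>R v) v"
    by auto
  then show ?thesis
    using a by (intro exI[of _ a] exI[of _ b]) (simp add: \<psi>_def swap algebra_simps)
qed

text \<open>The second difference is symmetric in \<open>u\<close> and \<open>v\<close>, and it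
  equals \<open>t * t\<close> times either mixed derivative at some point of the parallelogram. For
  small \<open>t\<close>, continuity makes this incompatible with a gap at \<open>x\<close>.\<close>

lemma ddir_commute_real:
  fixes F :: "'a::euclidean_space \<Rightarrow> real"
  assumes S: "open S" "x \<in> S" and F: "\<And>z. z \<in> S \<Longrightarrow> F differentiable (at z)"
    and G: "\<And>z w. z \<in> S \<Longrightarrow> (\<lambda>z. ddir F z w) differentiable (at z)"
    and cont: "\<And>w w'. continuous_on S (\<lambda>z. ddir (\<lambda>z. ddir F z w) z w')"
  shows "ddir (\<lambda>z. ddir F z u) x v = ddir (\<lambda>z. ddir F z v) x u"
proof (rule ccontr)
  let ?A = "\<lambda>z. ddir (\<lambda>z. ddir F z u) z v" and ?B = "\<lambda>z. ddir (\<lambda>z. ddir F z v) z u"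
  assume ne: "?A x \<noteq> ?B x"
  define \<epsilon> where "\<epsilon> = \<bar>?A x - ?B x\<bar> / 2"
  have \<epsilon>: "0 < \<epsilon>" using ne by (simp add: \<epsilon>_def)
  have "isCont ?A x" "isCont ?B x"
    using cont S continuous_on_eq_continuous_at by blast+
  then obtain d\<^sub>1 d\<^sub>2 where d: "0 < d\<^sub>1" "0 < d\<^sub>2" "\<And>z. dist z x < d\<^sub>1 \<Longrightarrow> dist (?A z) (?A x) < \<epsilon>"
    "\<And>z. dist z x < d\<^sub>2 \<Longrightarrow> dist (?B z) (?B x) < \<epsilon>"
    unfolding continuous_at_eps_delta using \<epsilon> by metis
  obtain d\<^sub>3 where d3: "0 < d\<^sub>3" "ball x d\<^sub>3 \<subseteq> S" using S open_contains_ball by blast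
  define d where "d = min d\<^sub>1 (min d\<^sub>2 d\<^sub>3)"
  \<comment> \<open>This keeps the whole parallelogram within distance \<open>d\<close> of
    \<open>x\<close>; the summand 1 makes the denominator positive even for
    \<open>u = v = 0\<close>.\<close>
  define t where "t = d / (2 * (norm u + norm v + 1))"
  have d0: "0 < d" using d d3 by (simp add: d_def)
  have t: "0 < t" using d0 by (simp add: t_def add_nonneg_pos)
  have near: "dist (x + a *\<^sub>R u + b *\<^sub>R v) x < d" if "0 \<le> a" "a \<le> t" "0 \<le> b" "b \<le> t" for a b
  proof -
    have "dist (x + a *\<^sub>R u + b *\<^sub>R v) x \<le> a * norm u + b * norm v"
      using norm_triangle_ineq[of "a *\<^sub>R u" "b *\<^sub>R v"] that by (simp add: dist_norm add.assoc)
    also have "\<dots> \<le> t * norm u + t * norm v"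
      using that by (intro add_mono mult_right_mono) auto
    also have "\<dots> < t * (2 * (norm u + norm v + 1))"
    proof -
      have "0 \<le> t * norm u" "0 \<le> t * norm v" using t by simp_all
      moreover have "t * (2 * (norm u + norm v + 1)) = 2 * (t * norm u) + 2 * (t * norm v) + 2 * t"
        by (simp add: algebra_simps)
      ultimately show ?thesis using t by linarith
    qed
    also have "\<dots> = d"
    proof -
      have "0 < 2 * (norm u + norm v + 1)" by (simp add: add_nonneg_pos)
      then show ?thesis by (simp add: t_def)
    qed
    finally show ?thesis .
  qed
  have inS: "x + a *\<^sub>R u + b *\<^sub>R v \<in> S" "x + a *\<^sub>R v + b *\<^sub>R u \<in> S"
    if "0 \<le> a" "a \<le> t" "0 \<le> b" "b \<le> t" for a b
    using near[OF that] near[OF that(3,4,1,2)] d3(2)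
    by (auto simp: d_def dist_commute add.assoc add.commute[of "a *\<^sub>R v"])
  obtain a b where ab: "0 < a" "a < t" "0 < b" "b < t"
    "F (x + t *\<^sub>R u + t *\<^sub>R v) - F (x + t *\<^sub>R u) - F (x + t *\<^sub>R v) + F x = t * t * ?A (x + a *\<^sub>R u + b *\<^sub>R v)"
    using second_difference_mvt[OF t inS(1) F G] by blast
  obtain a' b' where ab': "0 < a'" "a' < t" "0 < b'" "b' < t"
    "F (x + t *\<^sub>R v + t *\<^sub>R u) - F (x + t *\<^sub>R v) - F (x + t *\<^sub>R u) + F x = t * t * ?B (x + a' *\<^sub>R v + b' *\<^sub>R u)"
    using second_difference_mvt[OF t inS(2) F G] by blast
  have swap: "x + t *\<^sub>R v + t *\<^sub>R u = x + t *\<^sub>R u + t *\<^sub>R v" by simp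
  have "t * t * ?A (x + a *\<^sub>R u + b *\<^sub>R v) = t * t * ?B (x + a' *\<^sub>R v + b' *\<^sub>R u)"
    using ab(5) ab'(5) unfolding swap by linarith
  then have "?A (x + a *\<^sub>R u + b *\<^sub>R v) = ?B (x + b' *\<^sub>R u + a' *\<^sub>R v)"
    using t by (simp add: add.assoc add.commute[of "a' *\<^sub>R v"])
  moreover have "dist (?A (x + a *\<^sub>R u + b *\<^sub>R v)) (?A x) < \<epsilon>"
    by (rule d(3)) (use near[of a b] ab in \<open>simp add: d_def\<close>)
  moreover have "dist (?B (x + b' *\<^sub>R u + a' *\<^sub>R v)) (?B x) < \<epsilon>"
    by (rule d(4)) (use near[of b' a'] ab' in \<open>simp add: d_def\<close>)
  ultimately show False by (simp add: dist_real_def \<epsilon>_def abs_if split: if_splits)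
qed

lemma ddir_commute:
  fixes f :: "'a::euclidean_space \<Rightarrow> 'b::euclidean_space"
  assumes S: "open S" "x \<in> S" and f: "smooth_on S f"
  shows "ddir (\<lambda>z. ddir f z u) x v = ddir (\<lambda>z. ddir f z v) x u"
proof (rule euclidean_eqI)
  fix b :: 'b assume "b \<in> Basis"
  note f' = smooth_on_ddir[OF f] and f'' = smooth_on_ddir[OF smooth_on_ddir[OF f]]
  have d1: "((\<lambda>z. f z \<bullet> b) has_derivative (\<lambda>w. ddir f z w \<bullet> b)) (at z)" if "z \<in> S" for z
    by (intro has_derivative_inner_left ddir_works smooth_on_differentiable[OF f that])
  have d2: "((\<lambda>z. ddir f z w \<bullet> b) has_derivative (\<lambda>w'. ddir (\<lambda>z. ddir f z w) z w' \<bullet> b)) (at z)"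
    if "z \<in> S" for z w
    by (intro has_derivative_inner_left ddir_works smooth_on_differentiable[OF f' that])
  have e1: "ddir (\<lambda>z. f z \<bullet> b) z w = ddir f z w \<bullet> b" if "z \<in> S" for z w
    by (rule ddir_eqI[OF d1[OF that]])
  have d2': "((\<lambda>z. ddir (\<lambda>z. f z \<bullet> b) z w) has_derivative (\<lambda>w'. ddir (\<lambda>z. ddir f z w) z w' \<bullet> b)) (at z)"
    if "z \<in> S" for z w
    using has_derivative_transform_within_open[OF d2[OF that] S(1) that] e1 by simp
  have e2: "ddir (\<lambda>z. ddir (\<lambda>z. f z \<bullet> b) z w) z w' = ddir (\<lambda>z. ddir f z w) z w' \<bullet> b" if "z \<in> S" for z w w'
    by (rule ddir_eqI[OF d2'[OF that]])
  have "ddir (\<lambda>z. ddir (\<lambda>z. f z \<bullet> b) z u) x v = ddir (\<lambda>z. ddir (\<lambda>z. f z \<bullet> b) z v) x u"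
  proof (rule ddir_commute_real[OF S])
    show "(\<lambda>z. f z \<bullet> b) differentiable (at z)" if "z \<in> S" for z
      using d1[OF that] differentiableI by blast
    show "(\<lambda>z. ddir (\<lambda>z. f z \<bullet> b) z w) differentiable (at z)" if "z \<in> S" for z w
      using d2'[OF that] differentiableI by blast
    show "continuous_on S (\<lambda>z. ddir (\<lambda>z. ddir (\<lambda>z. f z \<bullet> b) z w) z w')" for w w'
      using smooth_on_continuous[OF f''] by (subst continuous_on_cong[OF refl e2]) (auto intro!: continuous_intros)
  qed
  then show "ddir (\<lambda>z. ddir f z u) x v \<bullet> b = ddir (\<lambda>z. ddir f z v) x u \<bullet> b"
    by (simp add: e2 S)
qed

section \<open>Product rules for fields of linear and bilinear maps\<close>

lemma has_derivative_field:
  fixes A :: "'a::real_normed_vector \<Rightarrow> 'e::euclidean_space \<Rightarrow> 'b::real_normed_vector"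
  assumes S: "open S" "x \<in> S" and lin: "\<And>z. z \<in> S \<Longrightarrow> linear (A z)"
    and A: "\<And>v. (\<lambda>z. A z v) differentiable (at x)" and Y: "Y differentiable (at x)"
  shows "((\<lambda>z. A z (Y z)) has_derivative (\<lambda>u. ddir (\<lambda>z. A z (Y x)) x u + A x (ddir Y x u))) (at x)"
proof -
  have expand: "(\<Sum>b\<in>Basis. (w \<bullet> b) *\<^sub>R A z b) = A z w" if "z \<in> S" for z w
  proof -
    have "A z w = A z (\<Sum>b\<in>Basis. (w \<bullet> b) *\<^sub>R b)" by (simp add: euclidean_representation)
    then show ?thesis by (simp add: linear_sum[OF lin[OF that]] linear_cmul[OF lin[OF that]])
  qed
  have "((\<lambda>z. \<Sum>b\<in>Basis. (Y z \<bullet> b) *\<^sub>R A z b) has_derivative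
      (\<lambda>u. \<Sum>b\<in>Basis. (Y x \<bullet> b) *\<^sub>R ddir (\<lambda>z. A z b) x u + (ddir Y x u \<bullet> b) *\<^sub>R A x b)) (at x)"
    by (intro has_derivative_sum has_derivative_scaleR has_derivative_inner_left ddir_works A Y)
  then have 1: "((\<lambda>z. A z (Y z)) has_derivative
      (\<lambda>u. \<Sum>b\<in>Basis. (Y x \<bullet> b) *\<^sub>R ddir (\<lambda>z. A z b) x u + (ddir Y x u \<bullet> b) *\<^sub>R A x b)) (at x)"
    by (rule has_derivative_transform_within_open[OF _ S]) (simp add: expand)
  have "((\<lambda>z. \<Sum>b\<in>Basis. (Y x \<bullet> b) *\<^sub>R A z b) has_derivative
      (\<lambda>u. \<Sum>b\<in>Basis. (Y x \<bullet> b) *\<^sub>R ddir (\<lambda>z. A z b) x u)) (at x)"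
    by (intro has_derivative_sum has_derivative_scaleR_right ddir_works A)
  then have "((\<lambda>z. A z (Y x)) has_derivative
      (\<lambda>u. \<Sum>b\<in>Basis. (Y x \<bullet> b) *\<^sub>R ddir (\<lambda>z. A z b) x u)) (at x)"
    by (rule has_derivative_transform_within_open[OF _ S]) (simp add: expand)
  note 2 = ddir_eqI[OF this]
  show ?thesis
    using 1 by (simp add: sum.distrib expand S 2)
qed

lemma has_derivative_bilinear_field:
  fixes B :: "'a::real_normed_vector \<Rightarrow> 'e::euclidean_space \<Rightarrow> 'e \<Rightarrow> 'b::real_normed_vector"
  assumes S: "open S" "x \<in> S" and bil: "\<And>z. z \<in> S \<Longrightarrow> bilinear (B z)"
    and B: "\<And>u v. (\<lambda>z. B z u v) differentiable (at x)"
    and X: "X differentiable (at x)" and Y: "Y differentiable (at x)"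
  shows "((\<lambda>z. B z (X z) (Y z)) has_derivative (\<lambda>u. ddir (\<lambda>z. B z (X x) (Y x)) x u
    + B x (ddir X x u) (Y x) + B x (X x) (ddir Y x u))) (at x)"
proof -
  have 1: "((\<lambda>z. B z p (Y z)) has_derivative
      (\<lambda>u. ddir (\<lambda>z. B z p (Y x)) x u + B x p (ddir Y x u))) (at x)" for p
    by (rule has_derivative_field[OF S _ _ Y]) (use bil B in \<open>auto simp: bilinear_def\<close>)
  have "((\<lambda>z. B z (X z) (Y z)) has_derivative
      (\<lambda>u. ddir (\<lambda>z. B z (X x) (Y z)) x u + B x (ddir X x u) (Y x))) (at x)"
    by (rule has_derivative_field[OF S _ _ X, where A = "\<lambda>z p. B z p (Y z)"])
      (use bil differentiableI[OF 1] in \<open>auto simp: bilinear_def\<close>)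
  then show ?thesis by (simp add: ddir_eqI[OF 1] algebra_simps)
qed

text \<open>An injective linear \<open>L\<close> is bounded below, and so is \<open>A n\<close> for
  large \<open>n\<close>, uniformly. Hence the preimages \<open>\<eta> n\<close> stay bounded,
  \<open>L (\<eta> n)\<close> has the same limit as \<open>A n (\<eta> n)\<close>, and the range of
  \<open>L\<close> is closed.\<close>

lemma limit_in_range:
  fixes A :: "nat \<Rightarrow> 'f::euclidean_space \<Rightarrow> 'e::euclidean_space"
  assumes A: "\<And>n. linear (A n)" and L: "linear L" "inj L" and lim: "\<And>v. (\<lambda>n. A n v) \<longlonglongrightarrow> L v"
    and \<psi>: "(\<lambda>n. A n (\<eta> n)) \<longlonglongrightarrow> \<psi>"
  shows "\<psi> \<in> range L"
proof -
  obtain c where c: "0 < c" "\<And>v. c * norm v \<le> norm (L v)"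
    using linear_inj_bounded_below_pos[OF L] by metis
  define \<epsilon> where "\<epsilon> n = (\<Sum>b\<in>Basis. norm (A n b - L b))" for n
  have "\<epsilon> \<longlonglongrightarrow> (\<Sum>b\<in>(Basis::'f set). norm (L b - L b))"
    unfolding \<epsilon>_def by (intro tendsto_sum tendsto_norm tendsto_diff lim tendsto_const)
  then have \<epsilon>: "\<epsilon> \<longlonglongrightarrow> 0" by simp
  have bound: "norm (A n v - L v) \<le> \<epsilon> n * norm v" for n v
  proof -
    have "A n v - L v = (\<Sum>b\<in>Basis. (v \<bullet> b) *\<^sub>R (A n b - L b))"
    proof -
      have "A n v = (\<Sum>b\<in>Basis. (v \<bullet> b) *\<^sub>R A n b)" "L v = (\<Sum>b\<in>Basis. (v \<bullet> b) *\<^sub>R L b)"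
        using linear_sum[OF A, of n "\<lambda>b. (v \<bullet> b) *\<^sub>R b" Basis] linear_sum[OF L(1), of "\<lambda>b. (v \<bullet> b) *\<^sub>R b" Basis]
        by (simp_all add: euclidean_representation linear_cmul[OF A] linear_cmul[OF L(1)])
      then show ?thesis by (simp add: scaleR_diff_right sum_subtractf)
    qed
    also have "norm \<dots> \<le> (\<Sum>b\<in>Basis. norm v * norm (A n b - L b))"
      by (rule sum_norm_le) (simp add: mult_right_mono Basis_le_norm)
    finally show ?thesis by (simp add: \<epsilon>_def sum_distrib_left mult.commute)
  qed
  \<comment> \<open>Once the error is below \<open>c / 2\<close>, half of the lower bound
    \<open>c\<close> survives, which gives the factor \<open>2 / c\<close>.\<close>
  have "eventually (\<lambda>n. \<epsilon> n < c / 2) sequentially"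
    using \<epsilon> c(1) by (intro order_tendstoD) auto
  then have ev: "eventually (\<lambda>n. norm (A n (\<eta> n) - L (\<eta> n)) \<le> \<epsilon> n * (2 / c * norm (A n (\<eta> n)))) sequentially"
  proof eventually_elim
    case (elim n)
    have "c * norm (\<eta> n) \<le> norm (A n (\<eta> n)) + \<epsilon> n * norm (\<eta> n)"
      using c(2)[of "\<eta> n"] bound[of n "\<eta> n"] norm_triangle_ineq2[of "L (\<eta> n)" "A n (\<eta> n)"]
      by (simp add: norm_minus_commute)
    also have "\<epsilon> n * norm (\<eta> n) \<le> c / 2 * norm (\<eta> n)" using elim by (intro mult_right_mono) auto
    finally have "norm (\<eta> n) \<le> 2 / c * norm (A n (\<eta> n))" using c(1) by (simp add: field_simps)
    then have "\<epsilon> n * norm (\<eta> n) \<le> \<epsilon> n * (2 / c * norm (A n (\<eta> n)))"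
      by (rule mult_left_mono) (simp add: \<epsilon>_def sum_nonneg)
    then show ?case using bound[of n "\<eta> n"] by linarith
  qed
  have "(\<lambda>n. \<epsilon> n * (2 / c * norm (A n (\<eta> n)))) \<longlonglongrightarrow> 0 * (2 / c * norm \<psi>)"
    by (intro tendsto_mult \<epsilon> tendsto_const tendsto_norm \<psi>)
  then have "(\<lambda>n. A n (\<eta> n) - L (\<eta> n)) \<longlonglongrightarrow> 0"
    using Lim_null_comparison[OF ev] by simp
  from tendsto_diff[OF \<psi> this] have "(\<lambda>n. L (\<eta> n)) \<longlonglongrightarrow> \<psi>" by simp
  moreover have "closed (range L)"
    by (rule closed_subspace[OF linear_subspace_image[OF L(1) subspace_UNIV]])
  ultimately show ?thesis using closed_sequentially by (metis rangeI)
qed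

text \<open>Since \<open>r y = 0\<close>, the difference quotients of \<open>r\<close> along
  \<open>v\<close> lie in the ranges of \<open>A\<close> at points tending to \<open>y\<close>;
  \<open>limit_in_range\<close> carries this over to their limit \<open>D v\<close>. Nothing is
  asked of the coefficients that express \<open>r\<close> through \<open>A\<close>.\<close>

lemma derivative_in_range:
  fixes A :: "'f::euclidean_space \<Rightarrow> 'f \<Rightarrow> 'e::euclidean_space"
  assumes W: "open W" "y \<in> W" and A: "\<And>z. z \<in> W \<Longrightarrow> linear (A z)" and inj: "inj (A y)"
    and cont: "\<And>v. isCont (\<lambda>z. A z v) y"
    and r: "\<And>z. z \<in> W \<Longrightarrow> r z \<in> range (A z)" "r y = 0" and D: "(r has_derivative D) (at y)"
  shows "D v \<in> range (A y)"
proof -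
  have lim0: "(\<lambda>n. y + (1 / real (Suc n)) *\<^sub>R v) \<longlonglongrightarrow> y"
  proof -
    have "(\<lambda>n. y + (1 / real (Suc n)) *\<^sub>R v) \<longlonglongrightarrow> y + 0 *\<^sub>R v"
      by (intro tendsto_add tendsto_scaleR tendsto_const LIMSEQ_Suc[OF lim_1_over_n])
    then show ?thesis by simp
  qed
  then have "eventually (\<lambda>n. y + (1 / real (Suc n)) *\<^sub>R v \<in> W) sequentially"
    using W by (rule topological_tendstoD)
  then obtain N where N: "\<And>n. N \<le> n \<Longrightarrow> y + (1 / real (Suc n)) *\<^sub>R v \<in> W"
    unfolding eventually_sequentially by blast
  \<comment> \<open>The shift by \<open>N\<close> puts every point of the sequence inside
    \<open>W\<close>.\<close>
  define t where "t n = 1 / real (Suc (n + N))" for n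
  define p where "p n = y + t n *\<^sub>R v" for n
  have t: "0 < t n" for n by (simp add: t_def)
  have pW: "p n \<in> W" for n using N[of "n + N"] by (simp add: p_def t_def)
  have lim: "p \<longlonglongrightarrow> y" using LIMSEQ_ignore_initial_segment[OF lim0, of N] by (simp add: p_def[abs_def] t_def)
  have t0: "t \<longlonglongrightarrow> 0"
    using LIMSEQ_ignore_initial_segment[OF LIMSEQ_inverse_real_of_nat, of N] by (simp add: t_def[abs_def] inverse_eq_divide)
  have "\<exists>\<eta>. r (p n) = A (p n) \<eta>" for n using r(1)[OF pW] by blast
  then obtain \<eta> where \<eta>: "\<And>n. r (p n) = A (p n) (\<eta> n)" by metis
  have "((\<lambda>s. r (y + s *\<^sub>R v)) has_derivative (\<lambda>s. D (s *\<^sub>R v))) (at 0)"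
  proof -
    have "((\<lambda>s. y + s *\<^sub>R v) has_derivative (\<lambda>s. s *\<^sub>R v)) (at 0)"
      by (auto intro!: derivative_eq_intros)
    from has_derivative_compose[OF this, of r D] D show ?thesis by simp
  qed
  then have "((\<lambda>s. norm (r (y + s *\<^sub>R v) - D (s *\<^sub>R v)) / norm s) \<longlongrightarrow> 0) (at 0)"
    unfolding has_derivative_at by (simp add: r(2))
  moreover have "filterlim t (at 0) sequentially"
    using t0 t by (auto simp: filterlim_at less_imp_neq[symmetric])
  ultimately have "(\<lambda>n. norm (r (p n) - D (t n *\<^sub>R v)) / norm (t n)) \<longlonglongrightarrow> 0"
    unfolding p_def by (rule filterlim_compose)
  moreover have "norm (r (p n) - D (t n *\<^sub>R v)) / norm (t n) = norm ((1 / t n) *\<^sub>R r (p n) - D v)" for n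
  proof -
    have "(1 / t n) *\<^sub>R r (p n) - D v = (1 / t n) *\<^sub>R (r (p n) - D (t n *\<^sub>R v))"
      using t[of n] by (simp add: linear_cmul[OF has_derivative_linear[OF D]] scaleR_diff_right)
    then show ?thesis by simp
  qed
  ultimately have "(\<lambda>n. (1 / t n) *\<^sub>R r (p n)) \<longlonglongrightarrow> D v"
    by (simp add: tendsto_norm_zero_iff LIM_zero_iff)
  then have "(\<lambda>n. A (p n) ((1 / t n) *\<^sub>R \<eta> n)) \<longlonglongrightarrow> D v"
    by (simp add: \<eta> linear_cmul[OF A[OF pW]])
  moreover have "(\<lambda>n. A (p n) w) \<longlonglongrightarrow> A y w" for w
    using isCont_tendsto_compose[OF cont lim] .
  ultimately show ?thesis
    by (intro limit_in_range[of "\<lambda>n. A (p n)" "A y"] A pW W(2) inj)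
qed

section \<open>Invariant submanifolds of almost Hermitian manifolds\<close>

lemma linear_ddir_family:
  assumes S: "open S" "x \<in> S" and lin: "\<And>z. z \<in> S \<Longrightarrow> linear (A z)"
    and A: "\<And>v. (\<lambda>z. A z v) differentiable (at x)"
  shows "linear (\<lambda>v. ddir (\<lambda>z. A z v) x u)"
proof (rule linearI)
  fix v w
  have "ddir (\<lambda>z. A z (v + w)) x u = ddir (\<lambda>z. A z v + A z w) x u"
    by (rule ddir_cong[OF S]) (simp add: linear_add[OF lin])
  also have "\<dots> = ddir (\<lambda>z. A z v) x u + ddir (\<lambda>z. A z w) x u"
    by (rule ddir_eqI[OF has_derivative_add[OF ddir_works[OF A] ddir_works[OF A]]])
  finally show "ddir (\<lambda>z. A z (v + w)) x u = ddir (\<lambda>z. A z v) x u + ddir (\<lambda>z. A z w) x u" .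
next
  fix r v
  have "ddir (\<lambda>z. A z (r *\<^sub>R v)) x u = ddir (\<lambda>z. r *\<^sub>R A z v) x u"
    by (rule ddir_cong[OF S]) (simp add: linear_cmul[OF lin])
  also have "\<dots> = r *\<^sub>R ddir (\<lambda>z. A z v) x u"
    by (rule ddir_eqI[OF has_derivative_scaleR_right[OF ddir_works[OF A]]])
  finally show "ddir (\<lambda>z. A z (r *\<^sub>R v)) x u = r *\<^sub>R ddir (\<lambda>z. A z v) x u" .
qed

lemma orthonormal_basis_expansion:
  assumes bil: "bilinear h" and E: "orthonormal_basis h E"
  shows "v = (\<Sum>e\<in>E. h v e *\<^sub>R e)"
proof -
  have linl: "linear (\<lambda>u. h u z)" for z using bil by (simp add: bilinear_def)
  have "linear (\<lambda>v. \<Sum>e\<in>E. h v e *\<^sub>R e)"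
    by (rule linearI) (simp_all add: linear_add[OF linl] linear_cmul[OF linl] scaleR_add_left
        sum.distrib scaleR_sum_right)
  moreover have "e = (\<Sum>e'\<in>E. h e e' *\<^sub>R e')" if "e \<in> E" for e
  proof -
    have "(\<Sum>e'\<in>E. h e e' *\<^sub>R e') = (\<Sum>e'\<in>E. if e' = e then e else 0)"
      by (rule sum.cong) (use E that in \<open>auto simp: orthonormal_basis_def\<close>)
    then show ?thesis using E that by (simp add: orthonormal_basis_def)
  qed
  moreover have "v \<in> span E" using E by (simp add: orthonormal_basis_def)
  ultimately show ?thesis
    using linear_eq_on_span[of "\<lambda>v. v" "\<lambda>v. \<Sum>e\<in>E. h v e *\<^sub>R e" E v] linear_id[unfolded id_def] by blast
qed

text \<open>Skewness together with \<open>j (j u) = - u\<close> makes \<open>j\<close> orthogonal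
  for \<open>h\<close>, and the trace of a bilinear form is the same in any orthonormal
  frame.\<close>

lemma trace_orthogonal_complex_structure:
  fixes B :: "'f::euclidean_space \<Rightarrow> 'f \<Rightarrow> real"
  assumes h: "bilinear h" "\<And>u v. h u v = h v u" and B: "bilinear B"
    and E: "orthonormal_basis h E"
    and j: "\<And>u v. h (j u) v = - h u (j v)" "\<And>u. j (j u) = - u"
  shows "(\<Sum>e\<in>E. B (j e) (j e)) = (\<Sum>e\<in>E. B e e)"
proof -
  have linl: "linear (\<lambda>u. B u z)" and linr: "linear (B z)" and hl: "linear (\<lambda>u. h u z)"
    and hr: "linear (h z)" for z
    using B h(1) by (simp_all add: bilinear_def)
  have fin: "finite E" using E by (simp add: orthonormal_basis_def)
  have exp: "B u v = (\<Sum>a\<in>E. \<Sum>b\<in>E. h u a * h v b * B a b)" for u v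
  proof -
    have "B u v = (\<Sum>a\<in>E. h u a * B a v)"
      by (subst orthonormal_basis_expansion[OF h(1) E, of u])
        (simp add: linear_sum[OF linl] linear_cmul[OF linl])
    also have "\<dots> = (\<Sum>a\<in>E. h u a * (\<Sum>b\<in>E. h v b * B a b))"
      by (subst (1) orthonormal_basis_expansion[OF h(1) E, of v])
        (simp add: linear_sum[OF linr] linear_cmul[OF linr])
    finally show ?thesis by (simp add: sum_distrib_left mult.assoc)
  qed
  have orth: "(\<Sum>e\<in>E. h (j e) a * h (j e) b) = h a b" for a b
  proof -
    have "h a b = h (j a) (j b)" using j(1)[of a "j b"] j(2)[of b] by (simp add: linear_neg[OF hr])
    also have "\<dots> = h (\<Sum>e\<in>E. h (j a) e *\<^sub>R e) (j b)"
      using orthonormal_basis_expansion[OF h(1) E, of "j a"] by simp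
    also have "\<dots> = (\<Sum>e\<in>E. h (j a) e * h e (j b))"
      by (simp add: linear_sum[OF hl] linear_cmul[OF hl])
    also have "\<dots> = (\<Sum>e\<in>E. h (j e) a * h (j e) b)"
      by (rule sum.cong) (simp_all add: j(1) h(2)[of a])
    finally show ?thesis by simp
  qed
  have "(\<Sum>e\<in>E. B (j e) (j e)) = (\<Sum>e\<in>E. \<Sum>a\<in>E. \<Sum>b\<in>E. h (j e) a * h (j e) b * B a b)"
    by (simp add: exp[of "j _"])
  also have "\<dots> = (\<Sum>a\<in>E. \<Sum>e\<in>E. \<Sum>b\<in>E. h (j e) a * h (j e) b * B a b)" by (rule sum.swap)
  also have "\<dots> = (\<Sum>a\<in>E. \<Sum>b\<in>E. \<Sum>e\<in>E. h (j e) a * h (j e) b * B a b)"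
    by (intro sum.cong refl sum.swap)
  also have "\<dots> = (\<Sum>a\<in>E. \<Sum>b\<in>E. h a b * B a b)" by (simp add: sum_distrib_right[symmetric] orth)
  also have "\<dots> = (\<Sum>a\<in>E. \<Sum>b\<in>E. if b = a then B a a else 0)"
    by (intro sum.cong refl) (use E in \<open>auto simp: orthonormal_basis_def\<close>)
  also have "\<dots> = (\<Sum>e\<in>E. B e e)" using fin by simp
  finally show ?thesis .
qed

text \<open>An almost Hermitian structure on an open set, with a \<open>J\<close>-invariant
  submanifold given by its inclusion \<open>f\<close> in charts. The curvature is computed at the
  single point \<open>y\<close>.\<close>

locale hermitian_immersion =
  fixes U :: "'e::euclidean_space set" and g :: "'e \<Rightarrow> 'e \<Rightarrow> 'e \<Rightarrow> real" and J :: "'e \<Rightarrow> 'e \<Rightarrow> 'e"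
    and W :: "'f::euclidean_space set" and f :: "'f \<Rightarrow> 'e" and y :: 'f
  assumes open_U: "open U" and open_W: "open W" and y: "y \<in> W" and fU: "z \<in> W \<Longrightarrow> f z \<in> U"
    and smooth_f: "smooth_on W f" and inj_f: "inj (ddir f y)"
    and bil: "q \<in> U \<Longrightarrow> bilinear (g q)" and sym: "q \<in> U \<Longrightarrow> g q u v = g q v u"
    and pos: "q \<in> U \<Longrightarrow> v \<noteq> 0 \<Longrightarrow> 0 < g q v v"
    and dg: "(\<lambda>q. g q u v) differentiable (at (f y))"
    and lin_J: "q \<in> U \<Longrightarrow> linear (J q)" and J_J: "q \<in> U \<Longrightarrow> J q (J q v) = - v"
    and skew_J: "q \<in> U \<Longrightarrow> g q (J q u) v = - g q u (J q v)"
    and dJ: "(\<lambda>q. J q v) differentiable (at (f y))"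
    and invariant: "z \<in> W \<Longrightarrow> J (f z) ` range (ddir f z) \<subseteq> range (ddir f z)"
begin

abbreviation "x \<equiv> f y"
abbreviation "L \<equiv> ddir f y"
abbreviation "G a u v \<equiv> ddir (\<lambda>q. g q u v) x a"
abbreviation "DJ a v \<equiv> ddir (\<lambda>q. J q v) x a"
abbreviation "D2 u w \<equiv> ddir (\<lambda>z. ddir f z w) y u"

text \<open>The exterior derivative, without a normalising factor, of the fundamental form
  \<open>g q u (J q v)\<close>, evaluated on constant fields.\<close>

definition d\<Omega> :: "'e \<Rightarrow> 'e \<Rightarrow> 'e \<Rightarrow> real"
  where "d\<Omega> X Y V = ddir (\<lambda>q. g q Y (J q V)) x X + ddir (\<lambda>q. g q V (J q X)) x Y
    + ddir (\<lambda>q. g q X (J q Y)) x V"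

lemma x_U: "x \<in> U" by (rule fU[OF y])

lemma df: "z \<in> W \<Longrightarrow> f differentiable (at z)"
  by (rule smooth_on_differentiable[OF smooth_f])

lemma ddf: "z \<in> W \<Longrightarrow> (\<lambda>z. ddir f z v) differentiable (at z)"
  by (rule smooth_on_differentiable[OF smooth_on_ddir[OF smooth_f]])

lemma lin_L: "linear L" by (rule linear_ddir[OF df[OF y]])

lemma lin_g: "linear (g x u)" "linear (\<lambda>u. g x u v)"
  using bil[OF x_U] by (simp_all add: bilinear_def)

lemma lin_G: "linear (\<lambda>a. G a u v)" "linear (\<lambda>u. G a u v)" "linear (G a u)"
  using linear_ddir[OF dg] linear_ddir_family[OF open_U x_U, of "\<lambda>q. g q u"]
    linear_ddir_family[OF open_U x_U, of "\<lambda>q u. g q u v"] bil dg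
  by (auto simp: bilinear_def)

lemma lin_D2: "linear (\<lambda>u. D2 u w)" "linear (D2 u)"
  using linear_ddir[OF ddf[OF y]] linear_ddir_family[OF open_W y, of "ddir f"] linear_ddir[OF df] ddf[OF y]
  by auto

lemma G_sym: "G a u v = G a v u"
  by (rule ddir_cong[OF open_U x_U]) (rule sym)

lemma ddir_\<Omega>: "ddir (\<lambda>q. g q u (J q v)) x a = G a u (J x v) + g x u (DJ a v)"
  using ddir_eqI[OF has_derivative_bilinear_field[OF open_U x_U bil dg differentiable_const dJ]]
  by (simp add: linear_0[OF lin_g(2)])

text \<open>Obtained by differentiating \<open>J_J\<close>.\<close>

lemma DJ_J: "DJ a (J x v) = - J x (DJ a v)"
proof -
  have "ddir (\<lambda>q. J q (J q v)) x a = DJ a (J x v) + J x (DJ a v)"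
    by (rule ddir_eqI[OF has_derivative_field[OF open_U x_U lin_J dJ dJ]])
  moreover have "ddir (\<lambda>q. J q (J q v)) x a = ddir (\<lambda>q. - v) x a"
    by (rule ddir_cong[OF open_U x_U]) (rule J_J)
  ultimately show ?thesis by (simp add: eq_neg_iff_add_eq_0)
qed

text \<open>Obtained by differentiating the isometry property
  \<open>g q (J q v) (J q v) = g q v v\<close>.\<close>

lemma G_J: "G a (J x v) (J x v) = G a v v - 2 * g x (J x v) (DJ a v)"
proof -
  have "ddir (\<lambda>q. g q (J q v) (J q v)) x a = G a (J x v) (J x v) + g x (DJ a v) (J x v) + g x (J x v) (DJ a v)"
    by (rule ddir_eqI[OF has_derivative_bilinear_field[OF open_U x_U bil dg dJ dJ]])
  moreover have "ddir (\<lambda>q. g q (J q v) (J q v)) x a = G a v v"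
  proof (rule ddir_cong[OF open_U x_U])
    fix q assume q: "q \<in> U"
    show "g q (J q v) (J q v) = g q v v"
      using skew_J[OF q, of v "J q v"] J_J[OF q] bilinear_rneg[OF bil[OF q]] by simp
  qed
  ultimately show ?thesis using sym[OF x_U, of "DJ a v"] by simp
qed

text \<open>The form is chosen for \<open>B_J\<close>: the derivatives of \<open>g\<close> are the
  Koszul terms for the pairs \<open>(X, X)\<close> and \<open>(J x X, J x X)\<close>, and the
  derivatives of \<open>J\<close> are those produced by \<open>D2_J\<close>.\<close>

lemma d\<Omega>_J:
  "2 * d\<Omega> X (J x X) V = 2 * G X X V - G V X X + 2 * G (J x X) (J x X) V - G V (J x X) (J x X)
    + 2 * g x (J x (DJ X X) + DJ (J x X) X) V"
proof -
  define Y where "Y = J x X"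
  have JY: "J x Y = - X" by (simp add: Y_def J_J x_U)
  have "ddir (\<lambda>q. g q Y (J q V)) x X = ddir (\<lambda>q. - g q V (J q Y)) x X"
  proof (rule ddir_cong[OF open_U x_U])
    fix q assume q: "q \<in> U"
    show "g q Y (J q V) = - g q V (J q Y)" using skew_J[OF q, of V Y] sym[OF q, of Y "J q V"] by simp
  qed
  also have "\<dots> = - ddir (\<lambda>q. g q V (J q Y)) x X"
  proof (rule ddir_eqI[OF has_derivative_minus[OF ddir_works]])
    show "(\<lambda>q. g q V (J q Y)) differentiable (at x)"
      using has_derivative_bilinear_field[OF open_U x_U bil dg differentiable_const dJ] differentiableI by blast
  qed
  also have "\<dots> = G X X V + g x (J x (DJ X X)) V"
    unfolding ddir_\<Omega> JY unfolding Y_def DJ_J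
    by (simp add: linear_neg[OF lin_G(3)] linear_neg[OF lin_g(1)] G_sym[of X V] sym[OF x_U, of V])
  finally have 1: "ddir (\<lambda>q. g q Y (J q V)) x X = G X X V + g x (J x (DJ X X)) V" .
  have 2: "ddir (\<lambda>q. g q V (J q X)) x Y = G Y Y V + g x (DJ Y X) V"
    unfolding ddir_\<Omega> by (simp add: Y_def G_sym[of _ V] sym[OF x_U, of V])
  have "g x X (DJ V Y) = g x Y (DJ V X)"
    unfolding Y_def DJ_J using skew_J[OF x_U, of X "DJ V X"] by (simp add: linear_neg[OF lin_g(1)])
  then have 3: "ddir (\<lambda>q. g q X (J q Y)) x V = - G V X X + g x Y (DJ V X)"
    unfolding ddir_\<Omega> JY by (simp add: linear_neg[OF lin_G(3)])
  \<comment> \<open>\<open>G_J\<close> trades the derivative of \<open>J\<close> along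
    \<open>V\<close> for derivatives of \<open>g\<close>, which completes the Koszul terms.\<close>
  have "2 * g x Y (DJ V X) = G V X X - G V Y Y" using G_J[where a = V and v = X] by (simp add: Y_def)
  then show ?thesis
    using 1 2 3 unfolding d\<Omega>_def Y_def[symmetric] by (simp add: linear_add[OF lin_g(2)])
qed

text \<open>Differentiate \<open>J Df u = Df w\<close>, where \<open>w\<close> varies with the point. Its derivative only contributes a
  tangent vector, and by \<open>derivative_in_range\<close> its differentiability need not be known.\<close>

lemma D2_J:
  assumes w: "L w = J x (L u)"
  shows "\<exists>r. D2 v w = DJ (L v) (L u) + J x (D2 v u) + L r"
proof -
  have dJf: "((\<lambda>z. J (f z) p) has_derivative (\<lambda>v. DJ (L v) p)) (at y)" for p
    using has_derivative_compose[OF ddir_works[OF df[OF y]] ddir_works[OF dJ]] .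
  have "((\<lambda>z. J (f z) (ddir f z u)) has_derivative
      (\<lambda>v. ddir (\<lambda>z. J (f z) (L u)) y v + J x (D2 v u))) (at y)"
    using has_derivative_field[OF open_W y lin_J[OF fU] differentiableI[OF dJf] ddf[OF y]] .
  then have "((\<lambda>z. J (f z) (ddir f z u)) has_derivative (\<lambda>v. DJ (L v) (L u) + J x (D2 v u))) (at y)"
    by (simp add: ddir_eqI[OF dJf])
  from has_derivative_diff[OF ddir_works[OF ddf[OF y, of w]] this]
  have D: "((\<lambda>z. ddir f z w - J (f z) (ddir f z u)) has_derivative
      (\<lambda>v. D2 v w - (DJ (L v) (L u) + J x (D2 v u)))) (at y)" .
  \<comment> \<open>With \<open>w\<close> held fixed, the differentiated difference is tangent at
    every point by invariance, and it vanishes at \<open>y\<close> by the choice of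
    \<open>w\<close>.\<close>
  have "D2 v w - (DJ (L v) (L u) + J x (D2 v u)) \<in> range L"
  proof (rule derivative_in_range[where A = "ddir f", OF open_W y _ inj_f _ _ _ D])
    show "linear (ddir f z)" if "z \<in> W" for z by (rule linear_ddir[OF df[OF that]])
    show "isCont (\<lambda>z. ddir f z v) y" for v
      using differentiable_imp_continuous_within[OF ddf[OF y]] .
    show "ddir f z w - J (f z) (ddir f z u) \<in> range (ddir f z)" if z: "z \<in> W" for z
    proof -
      obtain a where "J (f z) (ddir f z u) = ddir f z a" using invariant[OF z] by blast
      then have "ddir f z w - J (f z) (ddir f z u) = ddir f z (w - a)"
        by (simp add: linear_diff[OF linear_ddir[OF df[OF z]]])
      then show ?thesis by simp
    qed
    show "ddir f y w - J x (ddir f y u) = 0" using w by simp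
  qed
  then obtain r where "D2 v w - (DJ (L v) (L u) + J x (D2 v u)) = L r" by blast
  then show ?thesis by (intro exI[of _ r]) (simp add: algebra_simps)
qed

section \<open>The second fundamental form and its trace\<close>

lemma christoffel_eq: "g x (christoffel g x u v) z = 1/2 * (G u v z + G v u z - G z u v)"
  using theI'[OF christoffel_exists_unique[OF open_U x_U bil sym[OF x_U] pos[OF x_U] dg]]
  unfolding christoffel_def by blast

text \<open>For normal \<open>V\<close> this is the second fundamental form paired with
  \<open>V\<close>; unlike the normal part, it has an explicit formula.\<close>

definition B :: "'e \<Rightarrow> 'f \<Rightarrow> 'f \<Rightarrow> real"
  where "B V u w = g x (cov_deriv_along g f (\<lambda>z. ddir f z w) y u) V"

lemma B_eq: "B V u w = g x (D2 u w) V + 1/2 * (G (L u) (L w) V + G (L w) (L u) V - G V (L u) (L w))"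
  by (simp add: B_def cov_deriv_along_def linear_add[OF lin_g(2)] christoffel_eq)

lemma bilinear_B: "bilinear (B V)"
  unfolding bilinear_def
proof (intro conjI allI)
  note lins = linear_add[OF lin_D2(1)] linear_add[OF lin_D2(2)] linear_add[OF lin_L]
    linear_add[OF lin_G(1)] linear_add[OF lin_G(2)] linear_add[OF lin_G(3)] linear_add[OF lin_g(2)]
    linear_cmul[OF lin_D2(1)] linear_cmul[OF lin_D2(2)] linear_cmul[OF lin_L]
    linear_cmul[OF lin_G(1)] linear_cmul[OF lin_G(2)] linear_cmul[OF lin_G(3)] linear_cmul[OF lin_g(2)]
  show "linear (B V u)" for u by (rule linearI) (simp_all add: B_eq lins algebra_simps)
  show "linear (\<lambda>u. B V u w)" for w by (rule linearI) (simp_all add: B_eq lins algebra_simps)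
qed

text \<open>Modulo tangent vectors, \<open>D2_J\<close> used twice expresses \<open>D2 w w\<close>
  as \<open>- D2 u u\<close> plus derivatives of \<open>J\<close>. The second derivatives of
  \<open>f\<close> therefore cancel in the sum, and \<open>d\<Omega>_J\<close> identifies the
  rest.\<close>

lemma B_J:
  assumes w: "L w = J x (L u)" and V: "\<And>v. g x (L v) V = 0"
  shows "B V u u + B V w w = d\<Omega> (L u) (J x (L u)) V"
proof -
  obtain r\<^sub>1 where 1: "D2 w w = DJ (L w) (L u) + J x (D2 w u) + L r\<^sub>1" using D2_J[OF w] by blast
  obtain r\<^sub>2 where 2: "D2 u w = DJ (L u) (L u) + J x (D2 u u) + L r\<^sub>2" using D2_J[OF w] by blast
  \<comment> \<open>Symmetry allows the second identity to be inserted into the first.\<close>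
  have "D2 w u = D2 u w" using ddir_commute[OF open_W y smooth_f] .
  then have "D2 w w = DJ (L w) (L u) + J x (DJ (L u) (L u)) - D2 u u + J x (L r\<^sub>2) + L r\<^sub>1"
    using 1 2 by (simp add: linear_add[OF lin_J[OF x_U]] J_J[OF x_U])
  moreover obtain r\<^sub>3 where "J x (L r\<^sub>2) = L r\<^sub>3" using invariant[OF y] by blast
  ultimately have "g x (D2 u u) V + g x (D2 w w) V = g x (J x (DJ (L u) (L u)) + DJ (L w) (L u)) V"
    using V by (simp add: linear_add[OF lin_g(2)] linear_diff[OF lin_g(2)])
  then have "2 * (B V u u + B V w w) = 2 * d\<Omega> (L u) (J x (L u)) V"
    unfolding d\<Omega>_J B_eq by (simp add: w algebra_simps)
  then show ?thesis by simp
qed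

lemma induced_metric:
  "bilinear (induced_metric g f y)"
  "induced_metric g f y u v = induced_metric g f y v u"
  "v \<noteq> 0 \<Longrightarrow> 0 < induced_metric g f y v v"
proof -
  show "bilinear (induced_metric g f y)"
    unfolding induced_metric_def bilinear_def
    by (auto intro!: linearI simp: linear_add[OF lin_L] linear_cmul[OF lin_L] linear_add[OF lin_g(1)]
        linear_add[OF lin_g(2)] linear_cmul[OF lin_g(1)] linear_cmul[OF lin_g(2)])
  show "induced_metric g f y u v = induced_metric g f y v u"
    by (simp add: induced_metric_def sym[OF x_U, of "L u"])
  show "0 < induced_metric g f y v v" if "v \<noteq> 0"
    using that inj_f linear_0[OF lin_L] unfolding induced_metric_def
    by (intro pos[OF x_U]) (metis injD)
qed

text \<open>Let \<open>j\<close> be \<open>J\<close> pulled back to the parameter space. The frames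
  \<open>e\<close> and \<open>j e\<close> give the same trace of \<open>B\<close>, so summing
  \<open>B_J\<close> counts that trace twice.\<close>

lemma sum_B:
  assumes E: "orthonormal_basis (induced_metric g f y) E" and V: "\<And>v. g x (L v) V = 0"
  shows "2 * (\<Sum>e\<in>E. B V e e) = (\<Sum>e\<in>E. d\<Omega> (L e) (J x (L e)) V)"
proof -
  have "\<exists>w. L w = J x (L u)" for u using invariant[OF y] by (metis image_subset_iff rangeE rangeI)
  then obtain j where j: "\<And>u. L (j u) = J x (L u)" by metis
  have "(\<Sum>e\<in>E. B V (j e) (j e)) = (\<Sum>e\<in>E. B V e e)"
  proof (rule trace_orthogonal_complex_structure[OF induced_metric(1,2) bilinear_B E])
    show "induced_metric g f y (j u) v = - induced_metric g f y u (j v)" for u v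
      by (simp add: induced_metric_def j skew_J x_U)
    show "j (j u) = - u" for u
      using inj_f by (rule injD) (simp add: j J_J x_U linear_neg[OF lin_L])
  qed
  then have "2 * (\<Sum>e\<in>E. B V e e) = (\<Sum>e\<in>E. B V e e + B V (j e) (j e))"
    by (simp add: sum.distrib)
  also have "\<dots> = (\<Sum>e\<in>E. d\<Omega> (L e) (J x (L e)) V)"
    by (rule sum.cong[OF refl B_J[OF j V]])
  finally show ?thesis .
qed

lemma normal_part_props:
  "v - normal_part (g x) (range L) v \<in> range L" "g x (normal_part (g x) (range L) v) (L w) = 0"
  using theI'[OF normal_part_exists_unique[OF bil[OF x_U] sym[OF x_U] pos[OF x_U] lin_L inj_f], of v]
  unfolding normal_part_def by blast+

text \<open>The trace \<open>H\<close> is itself normal, so it vanishes as soon as its products with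
  all normal vectors do, by the test \<open>V = H\<close>. These products are given by
  \<open>sum_B\<close>.\<close>

lemma mean_curvature_eq_0_iff:
  assumes E: "orthonormal_basis (induced_metric g f y) E"
  shows "(\<Sum>e\<in>E. second_fundamental_form g f y e e) = 0 \<longleftrightarrow>
    (\<forall>V. (\<forall>v. g x (L v) V = 0) \<longrightarrow> (\<Sum>e\<in>E. d\<Omega> (L e) (J x (L e)) V) = 0)"
proof -
  define H where "H = (\<Sum>e\<in>E. second_fundamental_form g f y e e)"
  have "g x (second_fundamental_form g f y u w) V = B V u w" if V: "\<And>v. g x (L v) V = 0" for u w V
  proof -
    let ?v = "cov_deriv_along g f (\<lambda>z. ddir f z w) y u"
    obtain a where "?v - normal_part (g x) (range L) ?v = L a" using normal_part_props(1)[of ?v] by blast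
    then have "g x ?v V - g x (normal_part (g x) (range L) ?v) V = 0"
      using V[of a] linear_diff[OF lin_g(2)] by metis
    then show ?thesis by (simp add: B_def second_fundamental_form_def)
  qed
  then have gH: "2 * g x H V = (\<Sum>e\<in>E. d\<Omega> (L e) (J x (L e)) V)" if "\<And>v. g x (L v) V = 0" for V
    using sum_B[OF E that] that by (simp add: H_def linear_sum[OF lin_g(2)])
  have "g x (L v) H = 0" for v
    unfolding H_def second_fundamental_form_def
    by (simp add: linear_sum[OF lin_g(1)] sym[OF x_U, of "L v"] normal_part_props(2))
  then have "H = 0" if "\<And>V. (\<And>v. g x (L v) V = 0) \<Longrightarrow> (\<Sum>e\<in>E. d\<Omega> (L e) (J x (L e)) V) = 0"
    using gH[of H] that[of H] pos[OF x_U, of H] by force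
  moreover have "(\<Sum>e\<in>E. d\<Omega> (L e) (J x (L e)) V) = 0" if "H = 0" "\<And>v. g x (L v) V = 0" for V
    using gH[OF that(2)] that(1) linear_0[OF lin_g(2)] by simp
  ultimately show ?thesis unfolding H_def by blast
qed

end

section \<open>Submanifolds of metric contact pairs\<close>

lemma ext_deriv_eq:
  assumes "linear (a x)"
  shows "ext_deriv a x u v = 1/2 * (ddir (\<lambda>z. a z v) x u - ddir (\<lambda>z. a z u) x v)"
  using linear_0[OF assms]
  by (simp add: ext_deriv_def ext_deriv_fields_def lie_bracket_def frechet_derivative_const)

lemma ext_deriv_skew:
  assumes "linear (a x)"
  shows "ext_deriv a x u v = - ext_deriv a x v u"
  by (simp add: ext_deriv_eq[where a = a and x = x, OF assms] field_simps)

lemma bilinear_ext_deriv: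
  assumes S: "open S" "x \<in> S" and lin: "\<And>z. z \<in> S \<Longrightarrow> linear (a z)"
    and a: "\<And>v. (\<lambda>z. a z v) differentiable (at x)"
  shows "bilinear (ext_deriv a x)"
proof -
  have "linear (\<lambda>u. ddir (\<lambda>z. a z v) x u)" "linear (\<lambda>v. ddir (\<lambda>z. a z v) x u)" for u v
    using linear_ddir[OF a] linear_ddir_family[OF S lin a] by auto
  note lins = linear_add[OF this(1)] linear_add[OF this(2)] linear_cmul[OF this(1)] linear_cmul[OF this(2)]
  have "ext_deriv a x = (\<lambda>u v. 1/2 * (ddir (\<lambda>z. a z v) x u - ddir (\<lambda>z. a z u) x v))"
    by (intro ext ext_deriv_eq[where a = a and x = x, OF lin[OF S(2)]])
  then show ?thesis
    unfolding bilinear_def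
    by (auto intro!: linearI simp: lins field_simps)
qed

text \<open>Since \<open>d(d\<alpha>\<^sub>i) = 0\<close>, the exterior derivative of the fundamental form only sees
  \<open>d(\<alpha>\<^sub>1 \<and> \<alpha>\<^sub>2)\<close>.\<close>

lemma ext_deriv_fundamental_form:
  fixes \<alpha>\<^sub>1 \<alpha>\<^sub>2 :: "'e::euclidean_space \<Rightarrow> 'e \<Rightarrow> real"
  assumes S: "open S" "x \<in> S"
    and lin: "\<And>z. z \<in> S \<Longrightarrow> linear (\<alpha>\<^sub>1 z)" "\<And>z. z \<in> S \<Longrightarrow> linear (\<alpha>\<^sub>2 z)"
    and sm: "\<And>v. smooth_on S (\<lambda>z. \<alpha>\<^sub>1 z v)" "\<And>v. smooth_on S (\<lambda>z. \<alpha>\<^sub>2 z v)"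
    and \<Omega>: "\<And>z u v. z \<in> S \<Longrightarrow> \<Omega> z u v
      = ext_deriv \<alpha>\<^sub>1 z u v + ext_deriv \<alpha>\<^sub>2 z u v - \<alpha>\<^sub>1 z u * \<alpha>\<^sub>2 z v + \<alpha>\<^sub>2 z u * \<alpha>\<^sub>1 z v"
  defines "b\<^sub>1 \<equiv> ext_deriv \<alpha>\<^sub>1 x" and "b\<^sub>2 \<equiv> ext_deriv \<alpha>\<^sub>2 x"
  shows "ddir (\<lambda>z. \<Omega> z Y V) x X + ddir (\<lambda>z. \<Omega> z V X) x Y + ddir (\<lambda>z. \<Omega> z X Y) x V
    = - 2 * ((b\<^sub>1 X Y * \<alpha>\<^sub>2 x V + b\<^sub>1 Y V * \<alpha>\<^sub>2 x X + b\<^sub>1 V X * \<alpha>\<^sub>2 x Y)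
      - (b\<^sub>2 X Y * \<alpha>\<^sub>1 x V + b\<^sub>2 Y V * \<alpha>\<^sub>1 x X + b\<^sub>2 V X * \<alpha>\<^sub>1 x Y))"
proof -
  \<comment> \<open>The first argument of \<open>D\<^sub>1\<close> and \<open>H\<^sub>1\<close> is
    the vector fed to the form; the later ones are directions of differentiation.\<close>
  define D\<^sub>1 where "D\<^sub>1 v u = ddir (\<lambda>z. \<alpha>\<^sub>1 z v) x u" for u v
  define D\<^sub>2 where "D\<^sub>2 v u = ddir (\<lambda>z. \<alpha>\<^sub>2 z v) x u" for u v
  define H\<^sub>1 where "H\<^sub>1 v u w = ddir (\<lambda>z. ddir (\<lambda>z. \<alpha>\<^sub>1 z v) z u) x w" for u v w
  define H\<^sub>2 where "H\<^sub>2 v u w = ddir (\<lambda>z. ddir (\<lambda>z. \<alpha>\<^sub>2 z v) z u) x w" for u v w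
  have H_sym: "H\<^sub>1 v u w = H\<^sub>1 v w u" "H\<^sub>2 v u w = H\<^sub>2 v w u" for u v w
    unfolding H\<^sub>1_def H\<^sub>2_def by (rule ddir_commute[OF S sm(1)], rule ddir_commute[OF S sm(2)])
  have d: "((\<lambda>z. \<alpha>\<^sub>1 z v) has_derivative D\<^sub>1 v) (at x)" "((\<lambda>z. \<alpha>\<^sub>2 z v) has_derivative D\<^sub>2 v) (at x)" for v
    unfolding D\<^sub>1_def[abs_def] D\<^sub>2_def[abs_def]
    using ddir_works[OF smooth_on_differentiable[OF sm(1) S(2)]]
      ddir_works[OF smooth_on_differentiable[OF sm(2) S(2)]] by blast+
  have h: "((\<lambda>z. ddir (\<lambda>z. \<alpha>\<^sub>1 z v) z u) has_derivative H\<^sub>1 v u) (at x)"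
    "((\<lambda>z. ddir (\<lambda>z. \<alpha>\<^sub>2 z v) z u) has_derivative H\<^sub>2 v u) (at x)" for u v
    unfolding H\<^sub>1_def[abs_def] H\<^sub>2_def[abs_def]
    using ddir_works[OF smooth_on_differentiable[OF smooth_on_ddir[OF sm(1)] S(2)]]
      ddir_works[OF smooth_on_differentiable[OF smooth_on_ddir[OF sm(2)] S(2)]] by blast+
  have \<Omega>': "ddir (\<lambda>z. \<Omega> z u v) x w = 1/2 * (H\<^sub>1 v u w - H\<^sub>1 u v w) + 1/2 * (H\<^sub>2 v u w - H\<^sub>2 u v w)
      - (\<alpha>\<^sub>1 x u * D\<^sub>2 v w + D\<^sub>1 u w * \<alpha>\<^sub>2 x v) + (\<alpha>\<^sub>2 x u * D\<^sub>1 v w + D\<^sub>2 u w * \<alpha>\<^sub>1 x v)" for u v w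
  proof -
    have "ddir (\<lambda>z. \<Omega> z u v) x w
      = ddir (\<lambda>z. 1/2 * (ddir (\<lambda>z. \<alpha>\<^sub>1 z v) z u - ddir (\<lambda>z. \<alpha>\<^sub>1 z u) z v)
        + 1/2 * (ddir (\<lambda>z. \<alpha>\<^sub>2 z v) z u - ddir (\<lambda>z. \<alpha>\<^sub>2 z u) z v)
        - \<alpha>\<^sub>1 z u * \<alpha>\<^sub>2 z v + \<alpha>\<^sub>2 z u * \<alpha>\<^sub>1 z v) x w"
      by (rule ddir_cong[OF S]) (simp only: \<Omega> ext_deriv_eq[of \<alpha>\<^sub>1, OF lin(1)] ext_deriv_eq[of \<alpha>\<^sub>2, OF lin(2)])
    also have "\<dots> = 1/2 * (H\<^sub>1 v u w - H\<^sub>1 u v w) + 1/2 * (H\<^sub>2 v u w - H\<^sub>2 u v w)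
      - (\<alpha>\<^sub>1 x u * D\<^sub>2 v w + D\<^sub>1 u w * \<alpha>\<^sub>2 x v) + (\<alpha>\<^sub>2 x u * D\<^sub>1 v w + D\<^sub>2 u w * \<alpha>\<^sub>1 x v)"
      by (rule ddir_eqI[where v = w]) (intro has_derivative_add has_derivative_diff has_derivative_mult_right
          has_derivative_mult d h)
    finally show ?thesis .
  qed
  have b: "b\<^sub>1 u v = 1/2 * (D\<^sub>1 v u - D\<^sub>1 u v)" "b\<^sub>2 u v = 1/2 * (D\<^sub>2 v u - D\<^sub>2 u v)" for u v
    unfolding b\<^sub>1_def b\<^sub>2_def D\<^sub>1_def D\<^sub>2_def
    using ext_deriv_eq[of \<alpha>\<^sub>1 x u v] ext_deriv_eq[of \<alpha>\<^sub>2 x u v] lin S(2) by simp_all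
  show ?thesis
    \<comment> \<open>By symmetry the second derivatives cancel in the cyclic sum; the first
      derivatives combine in pairs into the two 2-forms.\<close>
    unfolding \<Omega>' b H_sym(1)[of V Y X] H_sym(1)[of X V Y] H_sym(1)[of Y X V]
      H_sym(2)[of V Y X] H_sym(2)[of X V Y] H_sym(2)[of Y X V]
    by (simp add: algebra_simps)
qed

text \<open>The topology of the submanifold may be finer than the induced one. Continuity of the
  inclusion still makes the common domain open in it, and the chart of the submanifold carries this
  to the parameter space.\<close>

lemma chart_overlap_submanifold:
  assumes M: "smooth_manifold T A" and N: "submanifold T A S B" and d: "d \<in> B" and c: "c \<in> A"
  shows "open (chart_overlap d c)" "y \<in> chart_overlap d c \<Longrightarrow> chart_trans d c y \<in> chart_image c"
proof -
  have S: "smooth_manifold S B" "continuous_map S T id" using N by (auto simp: submanifold_def)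
  have od: "openin S (fst d)" "open (chart_image d)"
    and hom: "homeomorphic_map (subtopology S (fst d)) (top_of_set (chart_image d)) (snd d)"
    using S(1) d by (auto simp: smooth_manifold_def)
  have "openin T (fst c)" using M c by (auto simp: smooth_manifold_def)
  then have "openin S {p \<in> topspace S. id p \<in> fst c}" using S(2) by (rule openin_continuous_map_preimage[rotated])
  then have "openin S (fst d \<inter> {p \<in> topspace S. id p \<in> fst c})" using od(1) by blast
  moreover have "fst d \<inter> {p \<in> topspace S. id p \<in> fst c} = fst d \<inter> fst c"
    using openin_subset[OF od(1)] by auto
  ultimately have "openin S (fst d \<inter> fst c)" by simp
  moreover have "fst d \<inter> fst c = (fst d \<inter> fst c) \<inter> fst d" by blast
  ultimately have "openin (subtopology S (fst d)) (fst d \<inter> fst c)"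
    unfolding openin_subtopology by blast
  then have "openin (top_of_set (chart_image d)) (chart_overlap d c)"
    using homeomorphic_imp_open_map[OF hom] unfolding open_map_def chart_overlap_def by blast
  then show "open (chart_overlap d c)" using od(2) openin_open_trans by blast
  have "inj_on (snd d) (fst d)"
    using homeomorphic_imp_injective_map[OF hom] openin_subset[OF od(1)] by (simp add: Int_absorb1)
  then show "chart_trans d c y \<in> chart_image c" if "y \<in> chart_overlap d c"
    using that by (auto simp: chart_overlap_def chart_trans_def chart_image_def)
qed

text \<open>The bridge between the two locales: the exterior derivative of the fundamental form is
  \<open>-2\<close> times \<Theta>, so the vanishing of the mean curvature becomes the
  linear-algebra condition on the trace of \<Theta>.\<close>

lemma minimal_at_iff_reeb_tangent:
  fixes AM :: "('p, 'e::euclidean_space) chart set" and AN :: "('p, 'f::euclidean_space) chart set"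
  assumes M: "smooth_manifold TM AM" and mcp: "metric_contact_pair AM h k \<alpha>\<^sub>1 \<alpha>\<^sub>2 Z\<^sub>1 Z\<^sub>2 \<phi> g"
    and dec: "decomposable AM \<alpha>\<^sub>1 \<alpha>\<^sub>2 \<phi>"
    and N: "submanifold TM AM TN AN"
    and inv: "invariant_submanifold AM AN (mcp_J \<alpha>\<^sub>1 \<alpha>\<^sub>2 Z\<^sub>1 Z\<^sub>2 \<phi>)"
    and d: "d \<in> AN" and c: "c \<in> AM" and y: "y \<in> chart_overlap d c"
  shows "(\<forall>E. orthonormal_basis (induced_metric (g c) (chart_trans d c) y) E \<longrightarrow>
       (\<Sum>e\<in>E. second_fundamental_form (g c) (chart_trans d c) y e e) = 0) \<longleftrightarrow>
    Z\<^sub>1 c (chart_trans d c y) \<in> tangent_space d c y \<and> Z\<^sub>2 c (chart_trans d c y) \<in> tangent_space d c y"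
proof -
  let ?U = "chart_image c" and ?W = "chart_overlap d c" and ?f = "chart_trans d c"
  let ?x = "?f y" and ?J = "mcp_J \<alpha>\<^sub>1 \<alpha>\<^sub>2 Z\<^sub>1 Z\<^sub>2 \<phi> c" and ?L = "ddir (chart_trans d c) y"
  have open_U: "open ?U" using M c by (auto simp: smooth_manifold_def)
  note W = chart_overlap_submanifold[OF M N d c]
  have x: "?x \<in> ?U" by (rule W(2)[OF y])
  have \<alpha>: "\<And>v. smooth_on ?U (\<lambda>q. \<alpha>\<^sub>1 c q v)" "\<And>v. smooth_on ?U (\<lambda>q. \<alpha>\<^sub>2 c q v)"
    "\<And>q. q \<in> ?U \<Longrightarrow> linear (\<alpha>\<^sub>1 c q)" "\<And>q. q \<in> ?U \<Longrightarrow> linear (\<alpha>\<^sub>2 c q)"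
    using mcp c by (auto simp: metric_contact_pair_def contact_pair_def one_form_def)
  have Z: "smooth_on ?U (Z\<^sub>1 c)" "smooth_on ?U (Z\<^sub>2 c)"
    using mcp c by (auto simp: metric_contact_pair_def reeb_fields_def vector_field_def)
  have \<phi>: "\<And>v. smooth_on ?U (\<lambda>q. \<phi> c q v)" "\<And>q. q \<in> ?U \<Longrightarrow> linear (\<phi> c q)"
    using mcp c by (auto simp: metric_contact_pair_def endomorphism_field_def)
  have g: "\<And>u v. smooth_on ?U (\<lambda>q. g c q u v)" "\<And>q. q \<in> ?U \<Longrightarrow> bilinear (g c q)"
    "\<And>q u v. q \<in> ?U \<Longrightarrow> g c q u v = g c q v u" "\<And>q v. q \<in> ?U \<Longrightarrow> v \<noteq> 0 \<Longrightarrow> 0 < g c q v v"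
    using mcp c unfolding metric_contact_pair_def riemannian_metric_def by blast+
  \<comment> \<open>The identities are needed on the whole chart, because those for \<open>J\<close>
    and the fundamental form get differentiated.\<close>
  have point: "metric_contact_vector_space (g c q) (ext_deriv (\<alpha>\<^sub>1 c) q) (ext_deriv (\<alpha>\<^sub>2 c) q)
      (\<alpha>\<^sub>1 c q) (\<alpha>\<^sub>2 c q) (Z\<^sub>1 c q) (Z\<^sub>2 c q) (\<phi> c q) h k" if q: "q \<in> ?U" for q
  proof (rule metric_contact_vector_space.intro)
    show "bilinear (g c q)" by (rule g(2)[OF q])
    show "g c q u v = g c q v u" for u v by (rule g(3)[OF q])
    show "0 < g c q v v" if "v \<noteq> 0" for v by (rule g(4)[OF q that])
    show "bilinear (ext_deriv (\<alpha>\<^sub>1 c) q)"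
      using \<alpha>(3) smooth_on_differentiable[OF \<alpha>(1) q] by (rule bilinear_ext_deriv[OF open_U q])
    show "bilinear (ext_deriv (\<alpha>\<^sub>2 c) q)"
      using \<alpha>(4) smooth_on_differentiable[OF \<alpha>(2) q] by (rule bilinear_ext_deriv[OF open_U q])
    show "ext_deriv (\<alpha>\<^sub>1 c) q u v = - ext_deriv (\<alpha>\<^sub>1 c) q v u" "ext_deriv (\<alpha>\<^sub>2 c) q u v = - ext_deriv (\<alpha>\<^sub>2 c) q v u" for u v
      by (rule ext_deriv_skew[where x = q and a = "\<alpha>\<^sub>1 c", OF \<alpha>(3)[OF q]], rule ext_deriv_skew[where x = q and a = "\<alpha>\<^sub>2 c", OF \<alpha>(4)[OF q]])
    show "linear (\<phi> c q)" by (rule \<phi>(2)[OF q])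
    show "\<phi> c q (Z\<^sub>1 c q) = 0" "\<phi> c q (Z\<^sub>2 c q) = 0"
      using mcp c q unfolding metric_contact_pair_def by blast+
    show "\<phi> c q (\<phi> c q v) = - v + \<alpha>\<^sub>1 c q v *\<^sub>R Z\<^sub>1 c q + \<alpha>\<^sub>2 c q v *\<^sub>R Z\<^sub>2 c q" for v
      using mcp c q unfolding metric_contact_pair_def by blast
    show "g c q u (\<phi> c q v) = ext_deriv (\<alpha>\<^sub>1 c) q u v + ext_deriv (\<alpha>\<^sub>2 c) q u v" for u v
      using mcp c q unfolding metric_contact_pair_def by blast
    show "g c q v (Z\<^sub>1 c q) = \<alpha>\<^sub>1 c q v" "g c q v (Z\<^sub>2 c q) = \<alpha>\<^sub>2 c q v" for v
      using mcp c q unfolding metric_contact_pair_def by blast+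
    show "\<alpha>\<^sub>1 c q (Z\<^sub>1 c q) = 1" "\<alpha>\<^sub>1 c q (Z\<^sub>2 c q) = 0" "\<alpha>\<^sub>2 c q (Z\<^sub>1 c q) = 0" "\<alpha>\<^sub>2 c q (Z\<^sub>2 c q) = 1"
      using mcp c q unfolding metric_contact_pair_def reeb_fields_def by blast+
    show "ext_deriv (\<alpha>\<^sub>1 c) q (Z\<^sub>1 c q) v = 0" " ext_deriv (\<alpha>\<^sub>1 c) q (Z\<^sub>2 c q) v = 0"
      "ext_deriv (\<alpha>\<^sub>2 c) q (Z\<^sub>1 c q) v = 0" "ext_deriv (\<alpha>\<^sub>2 c) q (Z\<^sub>2 c q) v = 0" for v
      using mcp c q unfolding metric_contact_pair_def reeb_fields_def by blast+
    show "DIM('e) = 2 * h + 2 * k + 2" "wedge_power 2 (form2 (ext_deriv (\<alpha>\<^sub>1 c) q)) (h + 1) = (\<lambda>v. 0)"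
      "wedge_power 2 (form2 (ext_deriv (\<alpha>\<^sub>2 c) q)) (k + 1) = (\<lambda>v. 0)"
      using mcp c q unfolding metric_contact_pair_def contact_pair_def Let_def by blast+
    show "ext_deriv (\<alpha>\<^sub>1 c) q (\<phi> c q v) w = 0"
      if "\<alpha>\<^sub>1 c q v = 0" "\<And>w. ext_deriv (\<alpha>\<^sub>1 c) q v w = 0" for v w
    proof -
      have "v \<in> char_distribution (\<alpha>\<^sub>1 c) q" using that by (simp add: char_distribution_def)
      then have "\<phi> c q v \<in> char_distribution (\<alpha>\<^sub>1 c) q" using dec c q unfolding decomposable_def by blast
      then show ?thesis by (simp add: char_distribution_def)
    qed
    show "ext_deriv (\<alpha>\<^sub>2 c) q (\<phi> c q v) w = 0"
      if "\<alpha>\<^sub>2 c q v = 0" "\<And>w. ext_deriv (\<alpha>\<^sub>2 c) q v w = 0" for v w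
    proof -
      have "v \<in> char_distribution (\<alpha>\<^sub>2 c) q" using that by (simp add: char_distribution_def)
      then have "\<phi> c q v \<in> char_distribution (\<alpha>\<^sub>2 c) q" using dec c q unfolding decomposable_def by blast
      then show ?thesis by (simp add: char_distribution_def)
    qed
  qed
  have J: "metric_contact_vector_space.J (\<alpha>\<^sub>1 c q) (\<alpha>\<^sub>2 c q) (Z\<^sub>1 c q) (Z\<^sub>2 c q) (\<phi> c q) = ?J q"
    if "q \<in> ?U" for q
    by (rule ext) (simp add: metric_contact_vector_space.J_def[OF point[OF that]] mcp_J_def)
  interpret V: metric_contact_vector_space "g c ?x" "ext_deriv (\<alpha>\<^sub>1 c) ?x" "ext_deriv (\<alpha>\<^sub>2 c) ?x"
      "\<alpha>\<^sub>1 c ?x" "\<alpha>\<^sub>2 c ?x" "Z\<^sub>1 c ?x" "Z\<^sub>2 c ?x" "\<phi> c ?x" h k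
    by (rule point[OF x])
  interpret I: hermitian_immersion ?U "g c" ?J ?W ?f y
  proof (rule hermitian_immersion.intro)
    show "smooth_on ?W ?f" "inj ?L" using N d c y by (auto simp: submanifold_def)
    show "?J q (?J q v) = - v" "linear (?J q)" "g c q (?J q u) v = - g c q u (?J q v)" if "q \<in> ?U" for q u v
      using metric_contact_vector_space.lin_J[OF point[OF that]]
        metric_contact_vector_space.J_J[OF point[OF that]]
        metric_contact_vector_space.g_J_left[OF point[OF that]] by (simp_all add: J[OF that])
    show "(\<lambda>q. ?J q v) differentiable (at ?x)" for v
    proof -
      note works = ddir_works[OF smooth_on_differentiable[OF _ x]]
      show ?thesis
        unfolding mcp_J_def
        by (rule differentiableI, rule has_derivative_add[OF has_derivative_diff[OF works[OF \<phi>(1)]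
            has_derivative_scaleR[OF works[OF \<alpha>(2)] works[OF Z(1)]]]
            has_derivative_scaleR[OF works[OF \<alpha>(1)] works[OF Z(2)]]])
    qed
    show "?J (?f z) ` range (ddir ?f z) \<subseteq> range (ddir ?f z)" if "z \<in> ?W" for z
      using inv d c that unfolding invariant_submanifold_def tangent_space_def by blast
  qed (use open_U W y g smooth_on_differentiable[OF g(1) x] in \<open>auto\<close>)
  have d\<Omega>: "I.d\<Omega> X Y V = - 2 * V.\<Theta> X Y V" for X Y V
    unfolding I.d\<Omega>_def V.\<Theta>_def
  proof (rule ext_deriv_fundamental_form[OF open_U x \<alpha>(3,4,1,2)])
    show "g c q u (?J q v) = ext_deriv (\<alpha>\<^sub>1 c) q u v + ext_deriv (\<alpha>\<^sub>2 c) q u v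
        - \<alpha>\<^sub>1 c q u * \<alpha>\<^sub>2 c q v + \<alpha>\<^sub>2 c q u * \<alpha>\<^sub>1 c q v" if "q \<in> ?U" for q u v
      using metric_contact_vector_space.g_J[OF point[OF that]] by (simp add: J[OF that])
  qed
  have Jx: "V.J = ?J ?x" by (rule J[OF x])
  have JT: "V.J ` range ?L \<subseteq> range ?L" unfolding Jx by (rule I.invariant[OF y])
  \<comment> \<open>A Euclidean space type has positive dimension, and the inclusion is an
    immersion.\<close>
  have T: "range ?L \<noteq> {0}"
  proof
    assume zero: "range ?L = {0}"
    obtain b :: 'f where b: "b \<in> Basis" using nonempty_Basis by blast
    have "?L b \<in> range ?L" by (rule rangeI)
    then have "?L b = ?L 0" unfolding zero by (simp add: linear_0[OF I.lin_L])
    with I.inj_f have "b = 0" by (rule injD)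
    then show False using nonzero_Basis b by blast
  qed
  \<comment> \<open>The derivative of the inclusion maps an orthonormal basis for the induced metric
    to an orthonormal frame of the tangent space.\<close>
  have frame: "span (?L ` E) = range ?L" "finite (?L ` E)"
    "\<And>a b. a \<in> ?L ` E \<Longrightarrow> b \<in> ?L ` E \<Longrightarrow> g c ?x a b = (if a = b then 1 else 0)"
    "(\<Sum>e\<in>E. I.d\<Omega> (?L e) (?J ?x (?L e)) V) = - 2 * (\<Sum>e\<in>?L ` E. V.\<Theta> e (V.J e) V)"
    if E: "orthonormal_basis (induced_metric (g c) ?f y) E" for E V
  proof -
    have inj: "inj_on ?L E" using I.inj_f inj_on_subset by blast
    show "span (?L ` E) = range ?L"
      using E by (simp add: linear_span_image[OF I.lin_L] orthonormal_basis_def)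
    show "finite (?L ` E)" using E by (simp add: orthonormal_basis_def)
    show "g c ?x a b = (if a = b then 1 else 0)" if "a \<in> ?L ` E" "b \<in> ?L ` E" for a b
      using E that inj by (auto simp: orthonormal_basis_def induced_metric_def inj_on_def)
    show "(\<Sum>e\<in>E. I.d\<Omega> (?L e) (?J ?x (?L e)) V) = - 2 * (\<Sum>e\<in>?L ` E. V.\<Theta> e (V.J e) V)"
      by (simp add: sum.reindex[OF inj] d\<Omega> Jx sum_distrib_left)
  qed
  have iff: "(\<Sum>e\<in>E. second_fundamental_form (g c) ?f y e e) = 0 \<longleftrightarrow>
      Z\<^sub>1 c ?x \<in> range ?L \<and> Z\<^sub>2 c ?x \<in> range ?L"
    if E: "orthonormal_basis (induced_metric (g c) ?f y) E" for E
  proof -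
    note fr = frame[OF E]
    have orth: "(\<forall>v. g c ?x (?L v) V = 0) \<longleftrightarrow> (\<forall>t\<in>range ?L. g c ?x V t = 0)" for V
      using V.sym[of V] by auto
    have "(\<Sum>e\<in>E. second_fundamental_form (g c) ?f y e e) = 0 \<longleftrightarrow>
      (\<forall>V. (\<forall>t\<in>range ?L. g c ?x V t = 0) \<longrightarrow> (\<Sum>e\<in>?L ` E. V.\<Theta> e (V.J e) V) = 0)"
      unfolding I.mean_curvature_eq_0_iff[OF E] orth fr(4) by simp
    also have "\<dots> \<longleftrightarrow> Z\<^sub>1 c ?x \<in> range ?L \<and> Z\<^sub>2 c ?x \<in> range ?L"
      using V.sum_\<Theta>_eq_0_imp_reeb_tangent[OF fr(1) JT fr(2,3) _ T]
        V.reeb_tangent_imp_sum_\<Theta>_eq_0[OF fr(1) JT fr(2,3)] by blast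
    finally show ?thesis .
  qed
  \<comment> \<open>Existence of a basis prevents the quantified left-hand side from being vacuously
    true.\<close>
  have "\<exists>E. orthonormal_basis (induced_metric (g c) ?f y) E"
    by (rule orthonormal_basis_exists[OF I.induced_metric])
  then show ?thesis using iff unfolding tangent_space_def by blast
qed

theorem theorem26:
  fixes TM :: "'p topology" and AM :: "('p, 'e::euclidean_space) chart set"
    and TN :: "'p topology" and AN :: "('p, 'f::euclidean_space) chart set"
    and h k :: nat
    and \<alpha>\<^sub>1 \<alpha>\<^sub>2 :: "('p, 'e) chart \<Rightarrow> 'e \<Rightarrow> 'e \<Rightarrow> real"
    and Z\<^sub>1 Z\<^sub>2 :: "('p, 'e) chart \<Rightarrow> 'e \<Rightarrow> 'e"
    and \<phi> :: "('p, 'e) chart \<Rightarrow> 'e \<Rightarrow> 'e \<Rightarrow> 'e"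
    and g :: "('p, 'e) chart \<Rightarrow> 'e \<Rightarrow> 'e \<Rightarrow> 'e \<Rightarrow> real"
  assumes "smooth_manifold TM AM"
    and "metric_contact_pair AM h k \<alpha>\<^sub>1 \<alpha>\<^sub>2 Z\<^sub>1 Z\<^sub>2 \<phi> g"
    and "decomposable AM \<alpha>\<^sub>1 \<alpha>\<^sub>2 \<phi>"
    and "integrable_structure AM (mcp_J \<alpha>\<^sub>1 \<alpha>\<^sub>2 Z\<^sub>1 Z\<^sub>2 \<phi>)"
    and "submanifold TM AM TN AN"
    and "invariant_submanifold AM AN (mcp_J \<alpha>\<^sub>1 \<alpha>\<^sub>2 Z\<^sub>1 Z\<^sub>2 \<phi>)"
  shows "minimal_submanifold AM AN g \<longleftrightarrow>
    tangent_to_submanifold AM AN Z\<^sub>1 \<and> tangent_to_submanifold AM AN Z\<^sub>2"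
  unfolding minimal_submanifold_def tangent_to_submanifold_def
  using minimal_at_iff_reeb_tangent[OF assms(1,2,3,5,6)] by meson

end
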